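(* Let $c\ge 0$ and $p\ge 2$. Let $Y=(Y_1,\dots,Y_p)$ have independent components $Y_i\sim\mathrm{Poisson}(\theta_i)$ with $\theta=(\theta_1,\dots,\theta_p)\in(0,\infty)^p$ unknown, and put $Z=\sum_{i=1}^pY_i$ and $\gamma=\sum_{i=1}^p\theta_i$, so that $Z\sim\mathrm{Poisson}(\gamma)$. Let $\kappa$ be a real-valued function on $\{0,1,2,\dots\}$ and let $\delta=(\delta_1,\dots,\delta_p)$ be the estimator of $\theta$ of the form $$\delta_i=\frac{(1+c)\,\kappa(Z)}{p-1+(1+c)Z}\,Y_i,\qquad i=1,\dots,p.$$ Then $\delta$ is admissible for $(\theta_1,\dots,\theta_p)$ under the loss function $$L_c(\theta,\delta)=\sum_{i=1}^p\frac{(\delta_i-\theta_i)^2}{\theta_i}+c\,\frac{\bigl(\sum_{i=1}^p\delta_i-\gamma\bigr)^2}{\gamma}$$ if and only if $\kappa(Z)$ is admissible for $\gamma$, as an estimator based on $Z\sim\mathrm{Poisson}(\gamma)$, under the loss function $L(\gamma,\kappa)=(\kappa-\gamma)^2/\gamma$.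
   Context: The risk of an estimator is the expected loss as a function of the parameter. An estimator is admissible under a given loss function if no other estimator has risk that is less than or equal to its risk for every parameter value and strictly smaller for at least one parameter value.
   Formalization: As δ ignores κ(0), the "only if" fails as stated (κ(0)=-1, κ(z)=0 for z≥1: δ=0 is admissible, κ is not); so "δ admissible implies κ admissible" is stated for κ(0)=0, a normalization that leaves δ unchanged; the converse holds for all real κ. *)

theory Defs
  imports "HOL-Probability.Probability"
begin

text \<open>
  A discrete decision problem is given by a parameter set \<open>\<Theta>\<close>, a family \<open>P\<close> of distributions of
  the observation, and a nonnegative loss \<open>L\<close>, with the parameter as first argument of \<open>L\<close>.
  The risk takes values in \<open>[0, \<infinity>]\<close>, so an estimator is an arbitrary function of the observation
  and no integrability condition is imposed on it or on its competitors.  (For a loss that takes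
  negative values \<open>ennreal\<close> would truncate; the losses below are nonnegative on their
  parameter sets.)
\<close>

definition risk :: "('t \<Rightarrow> 'x pmf) \<Rightarrow> ('t \<Rightarrow> 'a \<Rightarrow> real) \<Rightarrow> ('x \<Rightarrow> 'a) \<Rightarrow> 't \<Rightarrow> ennreal" where
  "risk P L d t = (\<integral>\<^sup>+x. ennreal (L t (d x)) \<partial>measure_pmf (P t))"

definition dominates ::
    "'t set \<Rightarrow> ('t \<Rightarrow> 'x pmf) \<Rightarrow> ('t \<Rightarrow> 'a \<Rightarrow> real) \<Rightarrow> ('x \<Rightarrow> 'a) \<Rightarrow> ('x \<Rightarrow> 'a) \<Rightarrow> bool" where
  "dominates \<Theta> P L d' d \<longleftrightarrow>
     (\<forall>t\<in>\<Theta>. risk P L d' t \<le> risk P L d t) \<and> (\<exists>t\<in>\<Theta>. risk P L d' t < risk P L d t)"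

definition admissible ::
    "'t set \<Rightarrow> ('t \<Rightarrow> 'x pmf) \<Rightarrow> ('t \<Rightarrow> 'a \<Rightarrow> real) \<Rightarrow> ('x \<Rightarrow> 'a) \<Rightarrow> bool" where
  "admissible \<Theta> P L d \<longleftrightarrow> \<not> (\<exists>d'. dominates \<Theta> P L d' d)"

text \<open>
  Vectors of length \<open>p\<close> are functions on a finite type \<open>'n\<close> with \<open>p = CARD('n)\<close>.
  \<open>Pi_pmf UNIV\<close> is the product distribution, i.e. the coordinates are independent; its default
  value \<open>0\<close> is irrelevant because the index set is all of \<open>'n\<close>.
\<close>

definition positive_vectors :: "('n::finite \<Rightarrow> real) set" where
  "positive_vectors = {\<theta>. \<forall>i. 0 < \<theta> i}"

definition poisson_vector :: "('n::finite \<Rightarrow> real) \<Rightarrow> ('n \<Rightarrow> nat) pmf" where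
  "poisson_vector \<theta> = Pi_pmf UNIV 0 (\<lambda>i. poisson_pmf (\<theta> i))"

definition vector_loss :: "real \<Rightarrow> ('n::finite \<Rightarrow> real) \<Rightarrow> ('n \<Rightarrow> real) \<Rightarrow> real" where
  "vector_loss c \<theta> a =
     (\<Sum>i\<in>UNIV. (a i - \<theta> i)\<^sup>2 / \<theta> i)
     + c * (((\<Sum>i\<in>UNIV. a i) - (\<Sum>i\<in>UNIV. \<theta> i))\<^sup>2 / (\<Sum>i\<in>UNIV. \<theta> i))"

definition scalar_loss :: "real \<Rightarrow> real \<Rightarrow> real" where
  "scalar_loss \<gamma> a = (a - \<gamma>)\<^sup>2 / \<gamma>"

text \<open>
  The value \<open>\<kappa> 0\<close> has no influence on the following estimator: it is multiplied by \<open>y = 0\<close>.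
  It does matter for the admissibility of \<open>\<kappa>\<close> under \<open>scalar_loss\<close>.  For example, if
  \<open>\<kappa> 0 = -1\<close> and \<open>\<kappa> z = 0\<close> for \<open>z > 0\<close>, then \<open>\<kappa>\<close> is dominated by the zero estimator,
  while the vector estimator is identically zero and admissible.  So passing from admissibility of
  the vector estimator to that of \<open>\<kappa>\<close> requires the normalization \<open>\<kappa> 0 = 0\<close>.
\<close>

definition shrinkage_estimator ::
    "real \<Rightarrow> (nat \<Rightarrow> real) \<Rightarrow> ('n::finite \<Rightarrow> nat) \<Rightarrow> ('n \<Rightarrow> real)" where
  "shrinkage_estimator c \<kappa> y =
     (let z = (\<Sum>i\<in>UNIV. y i)
      in (\<lambda>i. (1 + c) * \<kappa> z / (real CARD('n) - 1 + (1 + c) * real z) * real (y i)))"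

end

theory Submission
  imports Defs
begin

text \<open>
  Write \<open>p = CARD('n)\<close>, \<open>\<gamma> = \<Sum>i. \<theta> i\<close>, \<open>z = \<Sum>i. y i\<close> and
  \<open>w z = (1 + c) * z / (p - 1 + (1 + c) * z)\<close>, a number in \<open>(0, 1)\<close> for \<open>z > 0\<close>, with \<open>w 0 = 0\<close>.

  The risk of the shrinkage estimator depends on \<open>\<theta>\<close> only through \<open>\<gamma>\<close>: it is \<open>1 + c\<close> times the
  Poisson expectation of \<open>w z * (\<kappa> z - \<gamma>)\<^sup>2 / \<gamma> + (1 - w z) * \<gamma>\<close> (lemma \<open>shrinkage_risk\<close>).  So the vector
  problem restricted to shrinkage estimators is the scalar problem with an additional weight \<open>w\<close>.
  Replacing \<open>\<kappa>\<close> by \<open>\<kappa> + d\<close> changes the scalar loss by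
  \<open>(2 * \<kappa> * d + d\<^sup>2) / \<gamma> - 2 * d\<close>, and replacing \<open>\<kappa>\<close> by \<open>\<kappa> + e / w\<close> changes the weighted loss by
  \<open>(2 * \<kappa> * e + e\<^sup>2 / w) / \<gamma> - 2 * e\<close>.  The two expressions differ only in the quadratic term.
  Since \<open>w \<le> 1\<close>, a weighted improvement \<open>e\<close> is a scalar improvement \<open>d = e\<close>.  Conversely, since
  \<open>w\<close> is at least \<open>w 1 > 0\<close> at positive counts, a scalar improvement \<open>d\<close> gives the weighted
  improvement \<open>e = w 1 * d\<close>, provided that \<open>d 0 = 0\<close>.  The last condition is where \<open>\<kappa> 0 = 0\<close> enters:
  a competitor of \<open>\<kappa>\<close> with finite risk must then vanish at \<open>0\<close> too, as \<open>\<gamma>\<close> tends to \<open>0\<close>.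

  An arbitrary competitor \<open>\<delta>'\<close> of the shrinkage estimator is reduced to a function of \<open>z\<close> by
  integrating its risk, at fixed \<open>\<gamma>\<close>, over \<open>\<theta> / \<gamma>\<close> uniform on the simplex (\<open>averaged_risk_strict\<close>).
  For this prior the posterior risk at \<open>y\<close> is a quadratic form in \<open>\<delta>' y\<close> that, for a given sum
  \<open>t = \<Sum>i. \<delta>' y i\<close>, is smallest when \<open>\<delta>' y\<close> is proportional to \<open>y\<close>; its minimum is a multiple of
  \<open>t\<^sup>2 / (w z * \<gamma>) - 2 * t + \<gamma>\<close>.  The marginal distribution of \<open>y\<close> given \<open>z\<close> is uniform, so by
  Jensen's inequality \<open>t\<close> can be replaced by its average \<open>s z\<close> over all \<open>y\<close> with total \<open>z\<close>.  As the
  risk of the shrinkage estimator is constant in \<open>\<theta> / \<gamma>\<close>, it follows that \<open>s - w * \<kappa>\<close> is a weighted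
  improvement in the sense above.

  Strictness and infinite risks are dealt with by convexity.  The midpoint of an estimator and a
  competitor dominating it has strictly smaller risk wherever the former has finite risk
  (\<open>strict_improvement\<close>), so that only parameters with finite risk have to be examined; and an estimator
  whose risk is infinite everywhere is dominated by the zero estimator.
\<close>

section \<open>Strictly convex losses\<close>

text \<open>
  A midpoint-convex loss makes the midpoint of \<open>d\<close> and \<open>d'\<close> no worse than the average of the two
  losses, and strictly better at an observation where \<open>d\<close> and \<open>d'\<close> differ.  Every observation has
  positive probability, so the gain survives in the risk as soon as the latter is finite.
  The purpose is to move strictness: domination promises a strict inequality at one parameter
  only, which may be one where the dominated estimator has infinite risk and no subtraction of
  risks is possible.  The midpoint is a parameter \<open>m\<close> because actions are real numbers in one
  application and functions in the other.
\<close>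

lemma strict_improvement:
  assumes dom: "dominates \<Theta> P L d' d"
    and supp: "\<And>t. t \<in> \<Theta> \<Longrightarrow> set_pmf (P t) = UNIV"
    and nonneg: "\<And>t a. t \<in> \<Theta> \<Longrightarrow> 0 \<le> L t a"
    and idem: "\<And>a. m a a = a"
    and conv: "\<And>t a b. t \<in> \<Theta> \<Longrightarrow> a \<noteq> b \<Longrightarrow> L t (m a b) < (L t a + L t b) / 2"
  obtains e where "\<And>t. t \<in> \<Theta> \<Longrightarrow> risk P L d t < \<infinity> \<Longrightarrow> risk P L e t < risk P L d t"
proof
  fix t assume t: "t \<in> \<Theta>" and fin: "risk P L d t < \<infinity>"
  define e where "e x = m (d' x) (d x)" for x
  have "d' \<noteq> d" using dom by (auto simp: dominates_def)
  then obtain x0 where x0: "d' x0 \<noteq> d x0" by auto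
  let ?g = "\<lambda>x. ennreal ((L t (d' x) + L t (d x)) / 2)"
  have le: "ennreal (L t (e x)) \<le> ?g x" for x
    using conv[OF t, of "d' x" "d x"] idem[of "d x"]
    by (cases "d' x = d x") (auto simp: e_def intro!: ennreal_leI)
  have "(\<integral>\<^sup>+x. ?g x \<partial>P t)
      = (\<integral>\<^sup>+x. ennreal (1/2) * ennreal (L t (d' x)) + ennreal (1/2) * ennreal (L t (d x)) \<partial>P t)"
  proof (intro nn_integral_cong)
    fix x
    have "(L t (d' x) + L t (d x)) / 2 = 1/2 * L t (d' x) + 1/2 * L t (d x)" by simp
    then show "?g x = ennreal (1/2) * ennreal (L t (d' x)) + ennreal (1/2) * ennreal (L t (d x))"
      using nonneg[OF t] by (simp only: ennreal_plus ennreal_mult' mult_nonneg_nonneg zero_le_divide_1_iff zero_le_numeral)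
  qed
  also have "\<dots> = ennreal (1/2) * risk P L d' t + ennreal (1/2) * risk P L d t"
    by (simp add: nn_integral_add nn_integral_cmult risk_def)
  also have "\<dots> \<le> ennreal (1/2) * risk P L d t + ennreal (1/2) * risk P L d t"
    using dom t by (intro add_mono mult_left_mono) (auto simp: dominates_def)
  also have "\<dots> = (ennreal (1/2) + ennreal (1/2)) * risk P L d t"
    by (simp only: distrib_right)
  also have "ennreal (1/2) + ennreal (1/2) = 1"
    by (subst ennreal_plus[symmetric]) auto
  finally have g: "(\<integral>\<^sup>+x. ?g x \<partial>P t) \<le> risk P L d t" by simp
  have "(\<integral>\<^sup>+x. ennreal (L t (e x)) \<partial>P t) < (\<integral>\<^sup>+x. ?g x \<partial>P t)"
  proof (rule nn_integral_less)
    have "(\<integral>\<^sup>+x. ennreal (L t (e x)) \<partial>P t) \<le> (\<integral>\<^sup>+x. ?g x \<partial>P t)"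
      by (intro nn_integral_mono le)
    then show "(\<integral>\<^sup>+x. ennreal (L t (e x)) \<partial>P t) \<noteq> \<infinity>"
      using g fin by (auto simp: top_unique)
    have "ennreal (L t (e x0)) < ?g x0"
      using conv[OF t x0] nonneg[OF t] by (auto simp: e_def intro!: ennreal_lessI order.strict_trans1[OF nonneg[OF t]])
    then show "\<not> (AE x in P t. ?g x \<le> ennreal (L t (e x)))"
      by (auto simp: AE_measure_pmf_iff supp[OF t] not_le)
  qed (use le in auto)
  then show "risk P L (\<lambda>x. m (d' x) (d x)) t < risk P L d t"
    using g by (simp add: risk_def e_def)
qed

text \<open>
  Risks are compared through sums, never through differences, as only some of them are known to be finite.
\<close>

lemma ennreal_less_of_add_le:
  fixes a b x y :: ennreal
  assumes "a + x \<le> b + y" "y < x" "b < \<infinity>"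
  shows "a < b"
proof (rule ccontr)
  assume "\<not> a < b"
  then have "b + x \<le> a + x" by (simp add: add_right_mono)
  also have "\<dots> \<le> b + y" by fact
  finally have "x \<le> y" using assms(3) by (auto simp: ennreal_add_left_cancel_le)
  then show False using assms(2) by simp
qed

lemma point_loss_le_risk: "ennreal (pmf (P t) x) * ennreal (L t (d x)) \<le> risk P L d t"
  unfolding risk_def nn_integral_measure_pmf by (rule nn_integral_ge_point) simp

text \<open>
  If \<open>a \<noteq> 0\<close>, the scaled error \<open>(a - t)\<^sup>2 / t\<close> explodes as \<open>t\<close> tends to \<open>0\<close>.  Both boundary
  arguments use this: an estimator of bounded risk cannot give a nonzero estimate to a parameter
  that may be arbitrarily small.
\<close>

lemma eq_0_if_square_bound_near_0:
  fixes a b B t0 :: real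
  assumes "0 < b" "0 < t0" and bound: "\<And>t. 0 < t \<Longrightarrow> t \<le> t0 \<Longrightarrow> b * ((a - t)\<^sup>2 / t) \<le> B"
  shows "a = 0"
proof -
  have "((\<lambda>t. b * (a - t)\<^sup>2) \<longlongrightarrow> b * (a - 0)\<^sup>2) (at_right 0)"
    by (intro tendsto_intros)
  moreover have "((\<lambda>t. B * t) \<longlongrightarrow> B * 0) (at_right 0)"
    by (intro tendsto_intros)
  moreover have "\<forall>\<^sub>F t in at_right 0. b * (a - t)\<^sup>2 \<le> B * t"
    using eventually_at_right_real[OF \<open>0 < t0\<close>]
  proof eventually_elim
    case (elim t)
    then show ?case using bound[of t] by (simp add: field_simps)
  qed
  ultimately have "b * (a - 0)\<^sup>2 \<le> B * 0"
    by (intro tendsto_le[of "at_right 0"]) auto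
  then show ?thesis using \<open>0 < b\<close> by (simp add: mult_le_0_iff)
qed

lemma sum_pos_vector: "\<theta> \<in> positive_vectors \<Longrightarrow> 0 < (\<Sum>i\<in>UNIV. \<theta> i)"
  by (intro sum_pos) (auto simp: positive_vectors_def)

lemma scalar_loss_nonneg: "0 < \<gamma> \<Longrightarrow> 0 \<le> scalar_loss \<gamma> a"
  by (simp add: scalar_loss_def)

lemma scalar_loss_midpoint:
  assumes "0 < \<gamma>" "a \<noteq> b"
  shows "scalar_loss \<gamma> ((a + b) / 2) < (scalar_loss \<gamma> a + scalar_loss \<gamma> b) / 2"
proof -
  have "scalar_loss \<gamma> ((a + b) / 2) + (a - b)\<^sup>2 / (4 * \<gamma>) = (scalar_loss \<gamma> a + scalar_loss \<gamma> b) / 2"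
    using assms by (simp add: scalar_loss_def field_simps power2_eq_square)
  moreover have "0 < (a - b)\<^sup>2 / (4 * \<gamma>)" using assms by simp
  ultimately show ?thesis by linarith
qed

lemma vector_loss_nonneg:
  assumes "0 \<le> c" "\<theta> \<in> positive_vectors"
  shows "0 \<le> vector_loss c \<theta> a"
  unfolding vector_loss_def using assms sum_pos_vector[OF assms(2)]
  by (auto intro!: add_nonneg_nonneg sum_nonneg mult_nonneg_nonneg divide_nonneg_nonneg
      simp: less_imp_le positive_vectors_def)

text \<open>
  This form lets strict convexity be inherited from the scalar loss.
\<close>

lemma vector_loss_alt:
  "vector_loss c \<theta> a = (\<Sum>i\<in>UNIV. scalar_loss (\<theta> i) (a i)) + c * scalar_loss (\<Sum>i\<in>UNIV. \<theta> i) (\<Sum>i\<in>UNIV. a i)"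
  by (simp add: vector_loss_def scalar_loss_def)

lemma vector_loss_midpoint:
  assumes c: "0 \<le> c" and \<theta>: "\<theta> \<in> positive_vectors" and ab: "a \<noteq> b"
  shows "vector_loss c \<theta> (\<lambda>i. (a i + b i) / 2) < (vector_loss c \<theta> a + vector_loss c \<theta> b) / 2"
proof -
  have le: "scalar_loss \<gamma> ((x + y) / 2) \<le> (scalar_loss \<gamma> x + scalar_loss \<gamma> y) / 2" if "0 < \<gamma>" for \<gamma> x y
    using scalar_loss_midpoint[OF that, of x y] by (cases "x = y") auto
  obtain j where j: "a j \<noteq> b j" using ab by auto
  have pos: "0 < \<theta> i" for i using \<theta> by (simp add: positive_vectors_def)
  have "(\<Sum>i\<in>UNIV. scalar_loss (\<theta> i) ((a i + b i) / 2))
      < (\<Sum>i\<in>UNIV. (scalar_loss (\<theta> i) (a i) + scalar_loss (\<theta> i) (b i)) / 2)"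
  proof (rule sum_strict_mono_ex1)
    show "\<forall>i\<in>UNIV. scalar_loss (\<theta> i) ((a i + b i) / 2)
        \<le> (scalar_loss (\<theta> i) (a i) + scalar_loss (\<theta> i) (b i)) / 2"
      using le pos by blast
    show "\<exists>i\<in>UNIV. scalar_loss (\<theta> i) ((a i + b i) / 2)
        < (scalar_loss (\<theta> i) (a i) + scalar_loss (\<theta> i) (b i)) / 2"
      using scalar_loss_midpoint[OF pos j] by blast
  qed simp
  moreover have "scalar_loss (sum \<theta> UNIV) (\<Sum>i\<in>UNIV. (a i + b i) / 2)
      \<le> (scalar_loss (sum \<theta> UNIV) (sum a UNIV) + scalar_loss (sum \<theta> UNIV) (sum b UNIV)) / 2"
    using le[OF sum_pos_vector[OF \<theta>], of "sum a UNIV" "sum b UNIV"]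
    by (simp add: sum.distrib sum_divide_distrib[symmetric])
  then have "c * scalar_loss (sum \<theta> UNIV) (\<Sum>i\<in>UNIV. (a i + b i) / 2)
      \<le> c * ((scalar_loss (sum \<theta> UNIV) (sum a UNIV) + scalar_loss (sum \<theta> UNIV) (sum b UNIV)) / 2)"
    using c by (rule mult_left_mono)
  ultimately show ?thesis
    by (simp add: vector_loss_alt sum.distrib sum_divide_distrib[symmetric] field_simps)
qed

text \<open>
  The parameter enters the term that is quadratic in a single coordinate through \<open>1 / \<theta> i\<close>, and all
  other terms through \<open>\<gamma>\<close> alone.  Hence inverse moments of the coordinates are all that averaging
  over the simplex will require.
\<close>

lemma vector_loss_expand:
  fixes \<theta> a :: "'n::finite \<Rightarrow> real"
  assumes "\<theta> \<in> positive_vectors"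
  defines "\<gamma> \<equiv> \<Sum>i\<in>UNIV. \<theta> i" and "s \<equiv> \<Sum>i\<in>UNIV. a i"
  shows "vector_loss c \<theta> a = (\<Sum>i\<in>UNIV. (a i)\<^sup>2 / \<theta> i) + (c * s\<^sup>2 / \<gamma> - 2 * (1 + c) * s + (1 + c) * \<gamma>)"
proof -
  have "(a i - \<theta> i)\<^sup>2 / \<theta> i = (a i)\<^sup>2 / \<theta> i - 2 * a i + \<theta> i" for i
    using assms(1) by (simp add: positive_vectors_def field_simps power2_eq_square less_imp_neq[symmetric])
  then have "(\<Sum>i\<in>UNIV. (a i - \<theta> i)\<^sup>2 / \<theta> i) = (\<Sum>i\<in>UNIV. (a i)\<^sup>2 / \<theta> i) - 2 * s + \<gamma>"
    by (simp add: sum.distrib sum_subtractf sum_distrib_left \<gamma>_def s_def)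
  moreover have "c * ((s - \<gamma>)\<^sup>2 / \<gamma>) = c * s\<^sup>2 / \<gamma> - 2 * c * s + c * \<gamma>"
    using sum_pos_vector[OF assms(1)] by (simp add: \<gamma>_def[symmetric] field_simps power2_eq_square)
  ultimately show ?thesis unfolding vector_loss_def by (simp add: s_def \<gamma>_def algebra_simps)
qed

text \<open>
  The zero estimator has finite risk, so it dominates every estimator whose risk is infinite
  everywhere; admissible estimators therefore have finite risk somewhere.
\<close>

lemma risk_zero_scalar: "risk poisson_pmf scalar_loss (\<lambda>_. 0) 1 < \<infinity>"
  by (simp add: risk_def scalar_loss_def)

lemma risk_zero_vector:
  fixes \<theta> :: "'n::finite \<Rightarrow> real"
  shows "risk poisson_vector (vector_loss c) (\<lambda>_ _. 0) \<theta> < \<infinity>"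
  by (simp add: risk_def ennreal_mult_less_top measure_pmf.emeasure_space_1)

lemma scalar_risk_finite_somewhere:
  assumes "admissible {0<..} poisson_pmf scalar_loss \<kappa>"
  obtains \<gamma> where "0 < \<gamma>" "risk poisson_pmf scalar_loss \<kappa> \<gamma> < \<infinity>"
proof (rule ccontr)
  note obtained = that
  assume "\<not> thesis"
  then have inf: "risk poisson_pmf scalar_loss \<kappa> t = \<infinity>" if "0 < t" for t
    using obtained[OF that] by (auto simp: less_top[symmetric])
  have "dominates {0<..} poisson_pmf scalar_loss (\<lambda>_. 0) \<kappa>"
    using risk_zero_scalar by (auto simp: dominates_def inf intro!: bexI[of _ 1])
  then show False using assms by (auto simp: admissible_def)
qed

lemma vector_risk_finite_somewhere:
  fixes d :: "('n::finite \<Rightarrow> nat) \<Rightarrow> 'n \<Rightarrow> real"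
  assumes "admissible positive_vectors poisson_vector (vector_loss c) d"
  obtains \<theta> where "\<theta> \<in> positive_vectors" "risk poisson_vector (vector_loss c) d \<theta> < \<infinity>"
proof (rule ccontr)
  note obtained = that
  assume "\<not> thesis"
  then have inf: "risk poisson_vector (vector_loss c) d t = \<infinity>" if "t \<in> positive_vectors" for t
    using obtained[OF that] by (auto simp: less_top[symmetric])
  have "(\<lambda>_. 1) \<in> (positive_vectors :: ('n \<Rightarrow> real) set)" by (simp add: positive_vectors_def)
  then have "dominates positive_vectors poisson_vector (vector_loss c) (\<lambda>_ _. 0) d"
    using risk_zero_vector[of c "\<lambda>_::'n. 1"] by (auto simp: dominates_def inf intro!: bexI[of _ "\<lambda>_. 1"])
  then show False using assms by (auto simp: admissible_def)
qed

section \<open>Poisson vectors with a given total count\<close>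

definition level :: "nat \<Rightarrow> ('n::finite \<Rightarrow> nat) set" where
  "level z = {y. (\<Sum>i\<in>UNIV. y i) = z}"

lemma finite_level [simp]: "finite (level z)"
proof (rule finite_subset)
  show "level z \<subseteq> PiE UNIV (\<lambda>_. {..z})"
    by (auto simp: level_def intro: member_le_sum)
qed (auto intro: finite_PiE)

lemma level_0: "level 0 = {\<lambda>_. 0}"
  by (auto simp: level_def)

text \<open>
  Sums over all count vectors are rearranged by total count.  The inner sums are finite, so that
  signed terms can be handled there as real numbers before passing to \<open>ennreal\<close>.
\<close>

lemma nn_integral_by_level:
  "(\<integral>\<^sup>+y. f y \<partial>measure_pmf P) = (\<Sum>z. \<Sum>y\<in>level z. ennreal (pmf P y) * f y)"
proof -
  let ?F = "\<lambda>y. ennreal (pmf P y) * f y"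
  have "(\<integral>\<^sup>+y. f y \<partial>measure_pmf P) = (\<integral>\<^sup>+y. ?F y \<partial>count_space UNIV)"
    by (rule nn_integral_measure_pmf)
  also have "\<dots> = (\<integral>\<^sup>+y. (\<integral>\<^sup>+z. ?F y * indicator (level z) y \<partial>count_space UNIV) \<partial>count_space UNIV)"
  proof (intro nn_integral_cong)
    fix y :: "'a \<Rightarrow> nat"
    show "?F y = (\<integral>\<^sup>+z. ?F y * indicator (level z) y \<partial>count_space UNIV)"
      by (subst nn_integral_count_space'[where A="{sum y UNIV}"]) (auto simp: level_def)
  qed
  also have "\<dots> = (\<integral>\<^sup>+z. (\<integral>\<^sup>+y. ?F y * indicator (level z) y \<partial>count_space UNIV) \<partial>count_space UNIV)"
    by (rule nn_integral_count_space_nn_integral) auto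
  also have "\<dots> = (\<integral>\<^sup>+z. (\<Sum>y\<in>level z. ?F y) \<partial>count_space UNIV)"
  proof (intro nn_integral_cong)
    fix z
    show "(\<integral>\<^sup>+y. ?F y * indicator (level z) y \<partial>count_space UNIV) = (\<Sum>y\<in>level z. ?F y)"
      by (subst nn_integral_count_space'[where A="level z"]) auto
  qed
  finally show ?thesis by (simp add: nn_integral_count_space_nat)
qed

lemma nn_integral_pmf_nat: "(\<integral>\<^sup>+z. f z \<partial>measure_pmf P) = (\<Sum>z. ennreal (pmf P z) * f (z::nat))"
  by (simp add: nn_integral_measure_pmf nn_integral_count_space_nat)

lemma pmf_poisson_vector:
  assumes "\<theta> \<in> positive_vectors"
  shows "pmf (poisson_vector \<theta>) y
           = exp (- (\<Sum>i\<in>UNIV. \<theta> i)) * (\<Prod>i\<in>UNIV. \<theta> i ^ y i) / (\<Prod>i\<in>UNIV. fact (y i))"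
  using assms unfolding poisson_vector_def
  by (subst pmf_Pi') (auto simp: positive_vectors_def prod.distrib prod_dividef exp_sum sum_negf[symmetric])

lemma set_pmf_poisson_vector:
  assumes "\<theta> \<in> positive_vectors"
  shows "set_pmf (poisson_vector \<theta>) = UNIV"
  using assms
  by (auto simp: set_pmf_iff pmf_poisson_vector positive_vectors_def less_imp_neq[symmetric])

lemma pmf_poisson_vector_increment:
  assumes "\<theta> \<in> positive_vectors"
  shows "real (Suc (y i)) * pmf (poisson_vector \<theta>) (y(i := Suc (y i))) = \<theta> i * pmf (poisson_vector \<theta>) y"
proof -
  have "(\<Prod>j\<in>UNIV. \<theta> j ^ (y(i := Suc (y i))) j) = \<theta> i * (\<Prod>j\<in>UNIV. \<theta> j ^ y j)"
    by (simp add: prod.remove[of UNIV i])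
  moreover have "(\<Prod>j\<in>UNIV. fact ((y(i := Suc (y i))) j) :: real) = real (Suc (y i)) * (\<Prod>j\<in>UNIV. fact (y j))"
    by (simp add: prod.remove[of UNIV i])
  moreover have "(\<Prod>j\<in>UNIV. fact (y j) :: real) \<noteq> 0" by simp
  ultimately show ?thesis
    using assms by (simp add: pmf_poisson_vector del: fun_upd_apply of_nat_Suc)
qed

text \<open>
  The vector form of the Poisson identity \<open>E (Y * g Y) = \<theta> * E (g (Y + 1))\<close>, localized at a
  total count.  It yields both the distribution of the total and the second moments, without
  any appeal to the multinomial distribution.
\<close>

lemma sum_level_Suc:
  fixes \<theta> :: "'n::finite \<Rightarrow> real"
  assumes "\<theta> \<in> positive_vectors"
  shows "(\<Sum>y\<in>level (Suc z). real (y i) * pmf (poisson_vector \<theta>) y * g y)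
       = \<theta> i * (\<Sum>y\<in>level z. pmf (poisson_vector \<theta>) y * g (y(i := Suc (y i))))"
proof -
  have inc: "sum (y(i := k)) UNIV + y i = sum y UNIV + k" for y :: "'n \<Rightarrow> nat" and k
    by (simp add: sum.remove[of UNIV i])
  have "(\<Sum>y\<in>level (Suc z). real (y i) * pmf (poisson_vector \<theta>) y * g y)
    = (\<Sum>y\<in>{y\<in>level (Suc z). y i \<noteq> 0}. real (y i) * pmf (poisson_vector \<theta>) y * g y)"
    by (intro sum.mono_neutral_right) auto
  also have "\<dots> = (\<Sum>y\<in>level z. real (Suc (y i)) * pmf (poisson_vector \<theta>) (y(i := Suc (y i)))
                     * g (y(i := Suc (y i))))"
  proof (rule sum.reindex_bij_witness[where i="\<lambda>y. y(i := Suc (y i))" and j="\<lambda>y. y(i := y i - 1)"])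
    fix y assume "y \<in> {y \<in> level (Suc z). y i \<noteq> 0}"
    then show "y(i := y i - 1) \<in> level z" using inc[of y "y i - 1"] by (auto simp: level_def)
  next
    fix y assume "y \<in> (level z :: ('n \<Rightarrow> nat) set)"
    then show "y(i := Suc (y i)) \<in> {y \<in> level (Suc z). y i \<noteq> 0}"
      using inc[of y "Suc (y i)"] by (auto simp: level_def)
  qed auto
  also have "\<dots> = \<theta> i * (\<Sum>y\<in>level z. pmf (poisson_vector \<theta>) y * g (y(i := Suc (y i))))"
    by (simp only: pmf_poisson_vector_increment[OF assms] sum_distrib_left mult.assoc)
  finally show ?thesis .
qed

text \<open>
  The total count of a Poisson vector is Poisson.  Summing the identity above over \<open>i\<close> gives the
  recursion \<open>(z + 1) * T (z + 1) = \<gamma> * T z\<close> for the mass \<open>T z\<close> of a level.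
\<close>

lemma pmf_level:
  fixes \<theta> :: "'n::finite \<Rightarrow> real"
  assumes \<theta>: "\<theta> \<in> positive_vectors"
  shows "(\<Sum>y\<in>level z. pmf (poisson_vector \<theta>) y) = pmf (poisson_pmf (\<Sum>i\<in>UNIV. \<theta> i)) z"
proof (induction z)
  case 0
  then show ?case using \<theta> sum_pos_vector[OF \<theta>] by (simp add: level_0 pmf_poisson_vector)
next
  case (Suc z)
  let ?p = "pmf (poisson_vector \<theta>)"
  \<comment> \<open>On the level of \<open>Suc z\<close> the factor \<open>Suc z\<close> is the sum of the counts.\<close>
  have "real (Suc z) * (\<Sum>y\<in>level (Suc z). ?p y)
      = (\<Sum>y\<in>level (Suc z). (\<Sum>i\<in>UNIV. real (y i)) * ?p y)"
    unfolding sum_distrib_left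
    by (intro sum.cong refl arg_cong2[where f="(*)"]) (auto simp: level_def simp flip: of_nat_sum)
  also have "\<dots> = (\<Sum>i\<in>UNIV. \<Sum>y\<in>level (Suc z). real (y i) * ?p y * 1)"
    by (simp add: sum_distrib_right) (rule sum.swap)
  also have "\<dots> = (\<Sum>i\<in>UNIV. \<theta> i) * (\<Sum>y\<in>level z. ?p y)"
    unfolding sum_level_Suc[OF \<theta>, where g="\<lambda>_. 1"] by (simp add: sum_distrib_right)
  finally have "real (Suc z) * (\<Sum>y\<in>level (Suc z). ?p y) = (\<Sum>i\<in>UNIV. \<theta> i) * (\<Sum>y\<in>level z. ?p y)" .
  then have "(\<Sum>y\<in>level (Suc z). ?p y) = (\<Sum>i\<in>UNIV. \<theta> i) * (\<Sum>y\<in>level z. ?p y) / real (Suc z)"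
    by (simp add: eq_divide_eq mult.commute del: of_nat_Suc)
  then show ?case unfolding Suc using sum_pos_vector[OF \<theta>] by (simp add: mult_ac)
qed

text \<open>
  The scaled second moments enter only through their sum over \<open>i\<close>, which depends on \<open>\<theta>\<close> through
  \<open>\<gamma>\<close> alone.  This is why the risk of an estimator proportional to \<open>y\<close> is a function of \<open>\<gamma>\<close>.
\<close>

lemma second_moment_level:
  fixes \<theta> :: "'n::finite \<Rightarrow> real"
  assumes \<theta>: "\<theta> \<in> positive_vectors"
  defines "\<gamma> \<equiv> \<Sum>i\<in>UNIV. \<theta> i"
  shows "(\<Sum>y\<in>level z. pmf (poisson_vector \<theta>) y * (\<Sum>i\<in>UNIV. (real (y i))\<^sup>2 / \<theta> i))
       = pmf (poisson_pmf \<gamma>) z * (real z * (real z + real CARD('n) - 1) / \<gamma>)"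
proof (cases z)
  case 0
  then show ?thesis by (simp add: level_0)
next
  case (Suc k)
  let ?p = "pmf (poisson_vector \<theta>)"
  have \<gamma>: "0 < \<gamma>" unfolding \<gamma>_def by (rule sum_pos_vector[OF \<theta>])
  have nz: "\<theta> i \<noteq> 0" for i using \<theta> by (auto simp: positive_vectors_def less_imp_neq[symmetric])
  have "(\<Sum>y\<in>level z. ?p y * (\<Sum>i\<in>UNIV. (real (y i))\<^sup>2 / \<theta> i))
      = (\<Sum>i\<in>UNIV. (\<Sum>y\<in>level (Suc k). real (y i) * ?p y * real (y i)) / \<theta> i)"
    unfolding Suc sum_distrib_left sum_divide_distrib
    by (subst sum.swap) (simp add: power2_eq_square mult_ac)
  also have "\<dots> = (\<Sum>i\<in>UNIV. \<Sum>y\<in>level k. ?p y * (real (y i) + 1))"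
    by (simp add: sum_level_Suc[OF \<theta>] nz add_ac)
  also have "\<dots> = (\<Sum>y\<in>level k. ?p y * (real k + real CARD('n)))"
    by (subst sum.swap, unfold sum_distrib_left[symmetric], intro sum.cong refl arg_cong2[where f="(*)"])
       (auto simp: level_def sum.distrib simp flip: of_nat_sum)
  also have "\<dots> = pmf (poisson_pmf \<gamma>) k * (real k + real CARD('n))"
    by (simp add: sum_distrib_right[symmetric] pmf_level[OF \<theta>] \<gamma>_def)
  also have "pmf (poisson_pmf \<gamma>) k = pmf (poisson_pmf \<gamma>) z * real z / \<gamma>"
    using \<gamma> by (simp add: Suc)
  finally show ?thesis by (simp add: Suc)
qed

section \<open>The risk of the shrinkage estimator\<close>

text \<open>
  The sum of the coordinates of the shrinkage estimator is \<open>shrink_weight c p z * \<kappa> z\<close>, and the same factor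
  turns out to weight the scalar loss in its risk.
\<close>

definition shrink_weight :: "real \<Rightarrow> nat \<Rightarrow> nat \<Rightarrow> real" where
  "shrink_weight c p z = (1 + c) * real z / (real p - 1 + (1 + c) * real z)"

lemma shrink_weight_0 [simp]: "shrink_weight c p 0 = 0"
  by (simp add: shrink_weight_def)

lemma shrink_denominator_pos:
  assumes "0 \<le> c" "2 \<le> p"
  shows "0 < real p - 1 + (1 + c) * real z"
proof (rule add_pos_nonneg)
  show "0 \<le> (1 + c) * real z" using assms by (intro mult_nonneg_nonneg) auto
qed (use assms in auto)

lemma shrink_weight_pos:
  assumes "0 \<le> c" "2 \<le> p" "0 < z"
  shows "0 < shrink_weight c p z"
  using assms shrink_denominator_pos[of c p z] unfolding shrink_weight_def
  by (intro divide_pos_pos mult_pos_pos) auto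

lemma shrink_weight_le_1:
  assumes "0 \<le> c" "2 \<le> p"
  shows "shrink_weight c p z \<le> 1"
  using assms shrink_denominator_pos[of c p z] unfolding shrink_weight_def by (simp add: divide_le_eq_1)

lemma shrink_weight_nonneg: "0 \<le> c \<Longrightarrow> 2 \<le> p \<Longrightarrow> 0 \<le> shrink_weight c p z"
  using shrink_weight_pos[of c p z] by (cases "z = 0") auto

lemma shrink_weight_1_le:
  assumes c: "0 \<le> c" and p: "2 \<le> p" and z: "0 < z"
  shows "shrink_weight c p 1 \<le> shrink_weight c p z"
proof -
  have "0 < real p - 1 + (1 + c)" "0 < real p - 1 + (1 + c) * real z"
    using shrink_denominator_pos[OF c p, of 1] shrink_denominator_pos[OF c p, of z] by auto
  moreover have "0 \<le> (1 + c) * (real p - 1) * (real z - 1)"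
    using c p z by (intro mult_nonneg_nonneg) auto
  ultimately show ?thesis
    unfolding shrink_weight_def by (simp add: divide_simps) (simp add: algebra_simps)
qed

text \<open>
  On a level the loss is a quadratic polynomial in the common factor \<open>A\<close> of \<open>y\<close>.  The factor in the
  definition of the estimator is the one for which the coefficients of \<open>\<kappa>\<^sup>2\<close>, \<open>\<kappa>\<close> and \<open>1\<close> recombine to
  a square weighted by \<open>w\<close>, plus a term that does not involve \<open>\<kappa>\<close>.
\<close>

lemma shrinkage_risk:
  fixes \<theta> :: "'n::finite \<Rightarrow> real"
  assumes c: "0 \<le> c" and p: "2 \<le> CARD('n)" and \<theta>: "\<theta> \<in> positive_vectors"
  defines "\<gamma> \<equiv> \<Sum>i\<in>UNIV. \<theta> i" and "w \<equiv> shrink_weight c CARD('n)"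
  shows "risk poisson_vector (vector_loss c) (shrinkage_estimator c \<kappa>) \<theta>
       = ennreal (1 + c) * (\<integral>\<^sup>+z. ennreal (w z * ((\<kappa> z - \<gamma>)\<^sup>2 / \<gamma>) + (1 - w z) * \<gamma>) \<partial>poisson_pmf \<gamma>)"
proof -
  let ?p = "pmf (poisson_vector \<theta>)"
  have \<gamma>: "0 < \<gamma>" unfolding \<gamma>_def by (rule sum_pos_vector[OF \<theta>])
  have pos: "0 < \<theta> i" for i using \<theta> by (auto simp: positive_vectors_def)
  have lev: "(\<Sum>y\<in>level z. ?p y * vector_loss c \<theta> (shrinkage_estimator c \<kappa> y))
      = pmf (poisson_pmf \<gamma>) z * ((1 + c) * (w z * ((\<kappa> z - \<gamma>)\<^sup>2 / \<gamma>) + (1 - w z) * \<gamma>))" for z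
  proof -
    define q where "q = real CARD('n) - 1 + (1 + c) * real z"
    define A where "A = (1 + c) * \<kappa> z / q"
    have q: "0 < q" using c p by (auto simp: q_def intro!: add_pos_nonneg)
    have loss: "vector_loss c \<theta> (shrinkage_estimator c \<kappa> y)
        = A\<^sup>2 * (\<Sum>i\<in>UNIV. (real (y i))\<^sup>2 / \<theta> i)
          + (\<gamma> - 2 * A * real z + c * ((A * real z - \<gamma>)\<^sup>2 / \<gamma>))"
      if "y \<in> level z" for y
    proof -
      have y: "(\<Sum>i\<in>UNIV. y i) = z" "(\<Sum>i\<in>UNIV. real (y i)) = real z"
        using that by (auto simp: level_def simp flip: of_nat_sum)
      have e: "shrinkage_estimator c \<kappa> y = (\<lambda>i. A * real (y i))"
        by (simp add: shrinkage_estimator_def y A_def q_def Let_def)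
      have "(A * real (y i) - \<theta> i)\<^sup>2 / \<theta> i = A\<^sup>2 * ((real (y i))\<^sup>2 / \<theta> i) - 2 * A * real (y i) + \<theta> i" for i
        using pos[of i] by (simp add: field_simps power2_eq_square)
      then show ?thesis unfolding vector_loss_def e
        by (simp add: sum.distrib sum_subtractf sum_distrib_left[symmetric] y \<gamma>_def del: times_divide_eq_right)
    qed
    have "(\<Sum>y\<in>level z. ?p y * vector_loss c \<theta> (shrinkage_estimator c \<kappa> y))
      = A\<^sup>2 * (\<Sum>y\<in>level z. ?p y * (\<Sum>i\<in>UNIV. (real (y i))\<^sup>2 / \<theta> i))
        + (\<Sum>y\<in>level z. ?p y) * (\<gamma> - 2 * A * real z + c * ((A * real z - \<gamma>)\<^sup>2 / \<gamma>))"
    proof -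
      define S C where "S y = (\<Sum>i\<in>UNIV. (real (y i))\<^sup>2 / \<theta> i)"
        and "C = \<gamma> - 2 * A * real z + c * ((A * real z - \<gamma>)\<^sup>2 / \<gamma>)" for y :: "'n \<Rightarrow> nat"
      have "(\<Sum>y\<in>level z. ?p y * (A\<^sup>2 * S y + C)) = A\<^sup>2 * (\<Sum>y\<in>level z. ?p y * S y) + (\<Sum>y\<in>level z. ?p y) * C"
        by (simp add: distrib_left sum.distrib sum_distrib_left sum_distrib_right mult_ac)
      then show ?thesis unfolding S_def C_def by (simp add: loss)
    qed
    also have "\<dots> = pmf (poisson_pmf \<gamma>) z * (A\<^sup>2 * (real z * (real z + real CARD('n) - 1) / \<gamma>)
         + (\<gamma> - 2 * A * real z + c * ((A * real z - \<gamma>)\<^sup>2 / \<gamma>)))"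
      unfolding second_moment_level[OF \<theta>] pmf_level[OF \<theta>] \<gamma>_def by (simp add: algebra_simps)
    also have "A\<^sup>2 * (real z * (real z + real CARD('n) - 1) / \<gamma>)
         + (\<gamma> - 2 * A * real z + c * ((A * real z - \<gamma>)\<^sup>2 / \<gamma>))
       = (A * q) * (A * real z) / \<gamma> + (1 + c) * \<gamma> - 2 * (1 + c) * (A * real z)"
      using \<gamma> by (simp add: q_def field_simps power2_eq_square)
    also have "A * q = (1 + c) * \<kappa> z" using q by (simp add: A_def)
    also have "A * real z = w z * \<kappa> z" by (simp add: A_def w_def shrink_weight_def q_def)
    also have "(1 + c) * \<kappa> z * (w z * \<kappa> z) / \<gamma> + (1 + c) * \<gamma> - 2 * (1 + c) * (w z * \<kappa> z)
      = (1 + c) * (w z * ((\<kappa> z - \<gamma>)\<^sup>2 / \<gamma>) + (1 - w z) * \<gamma>)"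
      using \<gamma> by (simp add: field_simps power2_eq_square)
    finally show ?thesis .
  qed
  have "risk poisson_vector (vector_loss c) (shrinkage_estimator c \<kappa>) \<theta>
     = (\<Sum>z. ennreal (\<Sum>y\<in>level z. ?p y * vector_loss c \<theta> (shrinkage_estimator c \<kappa> y)))"
    unfolding risk_def nn_integral_by_level
    by (simp add: sum_ennreal[symmetric] ennreal_mult' vector_loss_nonneg[OF c \<theta>])
  also have "\<dots> = (\<Sum>z. ennreal (pmf (poisson_pmf \<gamma>) z) *
      (ennreal (1 + c) * ennreal (w z * ((\<kappa> z - \<gamma>)\<^sup>2 / \<gamma>) + (1 - w z) * \<gamma>)))"
    using c by (simp only: lev ennreal_mult'[OF pmf_nonneg] ennreal_mult'[of "1 + c"] add_nonneg_nonneg zero_le_one)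
  also have "\<dots> = (\<integral>\<^sup>+z. ennreal (1 + c) * ennreal (w z * ((\<kappa> z - \<gamma>)\<^sup>2 / \<gamma>) + (1 - w z) * \<gamma>) \<partial>poisson_pmf \<gamma>)"
    by (rule nn_integral_pmf_nat[symmetric])
  also have "\<dots> = ennreal (1 + c) * (\<integral>\<^sup>+z. ennreal (w z * ((\<kappa> z - \<gamma>)\<^sup>2 / \<gamma>) + (1 - w z) * \<gamma>) \<partial>poisson_pmf \<gamma>)"
    by (rule nn_integral_cmult) auto
  finally show ?thesis .
qed

lemma weighted_risk_finite:
  assumes c: "0 \<le> c" and p: "2 \<le> p" and \<gamma>: "0 < \<gamma>"
    and fin: "risk poisson_pmf scalar_loss \<kappa> \<gamma> < \<infinity>"
  defines "w \<equiv> shrink_weight c p"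
  shows "(\<integral>\<^sup>+z. ennreal (w z * ((\<kappa> z - \<gamma>)\<^sup>2 / \<gamma>) + (1 - w z) * \<gamma>) \<partial>poisson_pmf \<gamma>) < \<infinity>"
proof -
  have "w z * ((\<kappa> z - \<gamma>)\<^sup>2 / \<gamma>) + (1 - w z) * \<gamma> \<le> scalar_loss \<gamma> (\<kappa> z) + \<gamma>" for z
    using shrink_weight_le_1[OF c p, of z] shrink_weight_nonneg[OF c p, of z] \<gamma>
    unfolding scalar_loss_def w_def
    by (intro add_mono mult_left_le_one_le mult_right_mono[where b="1::real" and c=\<gamma>, simplified]) auto
  then have "(\<integral>\<^sup>+z. ennreal (w z * ((\<kappa> z - \<gamma>)\<^sup>2 / \<gamma>) + (1 - w z) * \<gamma>) \<partial>poisson_pmf \<gamma>)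
      \<le> (\<integral>\<^sup>+z. ennreal (scalar_loss \<gamma> (\<kappa> z) + \<gamma>) \<partial>poisson_pmf \<gamma>)"
    by (intro nn_integral_mono ennreal_leI)
  also have "\<dots> = risk poisson_pmf scalar_loss \<kappa> \<gamma> + ennreal \<gamma>"
    using \<gamma> scalar_loss_nonneg[OF \<gamma>]
    by (simp add: risk_def nn_integral_add measure_pmf.emeasure_space_1)
  also have "\<dots> < \<infinity>" using fin by simp
  finally show ?thesis .
qed

text \<open>
  This makes the scalar risk finite wherever the weighted risk is.  It holds because the weights at
  positive counts are at least \<open>w 1\<close>.  At \<open>z = 0\<close>, where the weight vanishes, \<open>\<kappa> 0 = 0\<close> makes the scalar
  loss equal to \<open>\<gamma>\<close>, which is also the value of the weighted integrand.
\<close>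

lemma scalar_risk_le_weighted:
  assumes c: "0 \<le> c" and p: "2 \<le> p" and \<gamma>: "0 < \<gamma>" and "\<kappa> 0 = 0"
  defines "w \<equiv> shrink_weight c p"
  shows "ennreal (w 1) * risk poisson_pmf scalar_loss \<kappa> \<gamma>
       \<le> (\<integral>\<^sup>+z. ennreal (w z * ((\<kappa> z - \<gamma>)\<^sup>2 / \<gamma>) + (1 - w z) * \<gamma>) \<partial>poisson_pmf \<gamma>)"
proof -
  have w: "0 \<le> w z" "w z \<le> 1" for z
    using shrink_weight_le_1[OF c p, of z] shrink_weight_nonneg[OF c p, of z] by (auto simp: w_def)
  have pt: "w 1 * ((\<kappa> z - \<gamma>)\<^sup>2 / \<gamma>) \<le> w z * ((\<kappa> z - \<gamma>)\<^sup>2 / \<gamma>) + (1 - w z) * \<gamma>" for z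
  proof (cases "z = 0")
    case True
    then show ?thesis using \<gamma> w(2)[of 1] \<open>\<kappa> 0 = 0\<close>
      by (simp add: w_def power2_eq_square)
  next
    case False
    then have "w 1 * ((\<kappa> z - \<gamma>)\<^sup>2 / \<gamma>) \<le> w z * ((\<kappa> z - \<gamma>)\<^sup>2 / \<gamma>)"
      using \<gamma> shrink_weight_1_le[OF c p] by (intro mult_right_mono) (auto simp: w_def)
    moreover have "0 \<le> (1 - w z) * \<gamma>" using w[of z] \<gamma> by simp
    ultimately show ?thesis by linarith
  qed
  have "ennreal (w 1) * risk poisson_pmf scalar_loss \<kappa> \<gamma>
      = (\<integral>\<^sup>+z. ennreal (w 1 * ((\<kappa> z - \<gamma>)\<^sup>2 / \<gamma>)) \<partial>poisson_pmf \<gamma>)"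
    unfolding risk_def scalar_loss_def using w
    by (subst nn_integral_cmult[symmetric]) (auto simp: ennreal_mult' simp del: times_divide_eq_right)
  also have "\<dots> \<le> (\<integral>\<^sup>+z. ennreal (w z * ((\<kappa> z - \<gamma>)\<^sup>2 / \<gamma>) + (1 - w z) * \<gamma>) \<partial>poisson_pmf \<gamma>)"
    by (intro nn_integral_mono ennreal_leI pt)
  finally show ?thesis .
qed

section \<open>The uniform distribution on the simplex\<close>

lemma nn_integral_beta_nat:
  "(\<integral>\<^sup>+b. ennreal (indicator {0<..<1} b * (b ^ u * (1 - b) ^ v)) \<partial>lborel)
     = ennreal (fact u * fact v / fact (u + v + 1))"
proof (rule nn_integral_has_integral_lborel)
  have "Beta (real u + 1) (real v + 1) = fact u * fact v / fact (u + v + 1)"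
    using Gamma_fact[of u, where 'a=real] Gamma_fact[of v, where 'a=real]
      Gamma_fact[of "u + v + 1", where 'a=real]
    by (simp add: Beta_def algebra_simps)
  then have "((\<lambda>t. t powr real u * (1 - t) powr real v)
      has_integral (fact u * fact v / fact (u + v + 1) :: real)) {0<..<1}"
    using has_integral_Beta_real[of "real u + 1" "real v + 1"]
    by (simp add: has_integral_Icc_iff_Ioo)
  then have "((\<lambda>t. t ^ u * (1 - t) ^ v)
      has_integral (fact u * fact v / fact (u + v + 1) :: real)) {0<..<1}"
    by (subst (asm) has_integral_cong[where g="\<lambda>t. t ^ u * (1 - t) ^ v"]) (auto simp: powr_realpow)
  then have "((\<lambda>t. if t \<in> {0<..<1} then t ^ u * (1 - t) ^ v else 0)
      has_integral (fact u * fact v / fact (u + v + 1) :: real)) UNIV"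
    by (subst has_integral_restrict_UNIV)
  then show "((\<lambda>t. indicator {0<..<1} t * (t ^ u * (1 - t) ^ v))
      has_integral (fact u * fact v / fact (u + v + 1) :: real)) UNIV"
    by (rule has_integral_eq[rotated]) (auto simp: indicator_def)
qed (auto simp: indicator_def)

text \<open>
  The distribution \<open>Beta (1, k)\<close>: it is the law of one coordinate of a uniform point in the simplex with
  \<open>k + 1\<close> vertices, and the other coordinates, rescaled, are again uniform.
\<close>

definition stick_measure :: "nat \<Rightarrow> real measure" where
  "stick_measure k = density lborel (\<lambda>b. ennreal (indicator {0<..<1} b * (real k * (1 - b) ^ (k - 1))))"

lemma sets_stick_measure [measurable_cong]: "sets (stick_measure k) = sets borel"
  by (simp add: stick_measure_def)

lemma stick_power_measurable:
  "(\<lambda>b. ennreal (b ^ u * (1 - b) ^ v)) \<in> borel_measurable (stick_measure k)"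
  by measurable

lemma AE_stick_measure: "AE b in stick_measure k. 0 < b \<and> b < 1"
  unfolding stick_measure_def by (subst AE_density) (auto simp: indicator_def)

lemma stick_measure_moment:
  assumes "0 < k"
  shows "(\<integral>\<^sup>+b. ennreal (b ^ u * (1 - b) ^ v) \<partial>stick_measure k)
           = ennreal (real k * fact u * fact (v + k - 1) / fact (u + v + k))"
proof -
  have "(\<integral>\<^sup>+b. ennreal (b ^ u * (1 - b) ^ v) \<partial>stick_measure k)
    = (\<integral>\<^sup>+b. ennreal (real k) * ennreal (indicator {0<..<1} b * (b ^ u * (1 - b) ^ (v + k - 1))) \<partial>lborel)"
    unfolding stick_measure_def
    using assms
    by (subst nn_integral_density)
       (auto intro!: nn_integral_cong simp: indicator_def ennreal_mult'[symmetric] power_add[symmetric] algebra_simps)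
  also have "\<dots> = ennreal (real k) * ennreal (fact u * fact (v + k - 1) / fact (u + v + k))"
    using assms nn_integral_beta_nat[of u "v + k - 1"] by (subst nn_integral_cmult) (auto simp: add.assoc)
  finally show ?thesis by (simp add: ennreal_mult'[symmetric] mult.assoc add.assoc)
qed

text \<open>
  Stick-breaking: to a uniform point on the simplex over \<open>A\<close> a new coordinate \<open>b\<close> with law
  \<open>Beta (1, card A)\<close> is added, and the old coordinates are multiplied by \<open>1 - b\<close>.  The moments then
  factor into a Beta integral and the moments for \<open>A\<close>.
\<close>

lemma uniform_simplex_measure_exists:
  assumes "finite A" "A \<noteq> {}"
  shows "\<exists>M :: ('i \<Rightarrow> real) measure.
    sets M = sets (PiM UNIV (\<lambda>_. borel)) \<and>
    (AE x in M. (\<forall>i\<in>A. 0 < x i) \<and> sum x A = 1) \<and>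
    (\<forall>y. (\<integral>\<^sup>+x. ennreal (\<Prod>i\<in>A. x i ^ y i) \<partial>M)
           = ennreal ((\<Prod>i\<in>A. fact (y i)) * fact (card A - 1) / fact (sum y A + card A - 1)))"
  using assms
proof (induction rule: finite_ne_induct)
  case (singleton a)
  let ?M = "return (PiM UNIV (\<lambda>_. borel)) (\<lambda>_::'i. 1::real)"
  have [simp]: "(\<lambda>_::'i. 1::real) \<in> space (PiM UNIV (\<lambda>_. borel))" by (simp add: space_PiM)
  show ?case
  proof (intro exI[of _ ?M] conjI allI)
    show "AE x in ?M. (\<forall>i\<in>{a}. 0 < x i) \<and> sum x {a} = 1"
      by (subst AE_return) auto
    show "(\<integral>\<^sup>+x. ennreal (\<Prod>i\<in>{a}. x i ^ y i) \<partial>?M)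
      = ennreal ((\<Prod>i\<in>{a}. fact (y i)) * fact (card {a} - 1) / fact (sum y {a} + card {a} - 1))" for y
      by (subst nn_integral_return) auto
  qed simp
next
  case (insert a A)
  define k where "k = card A"
  have k: "0 < k" using insert by (auto simp: k_def card_gt_0_iff)
  obtain M :: "('i \<Rightarrow> real) measure" where
    M[measurable_cong]: "sets M = sets (PiM UNIV (\<lambda>_. borel))" and
    pos: "AE x in M. (\<forall>i\<in>A. 0 < x i) \<and> sum x A = 1" and
    mom: "\<And>y. (\<integral>\<^sup>+x. ennreal (\<Prod>i\<in>A. x i ^ y i) \<partial>M)
           = ennreal ((\<Prod>i\<in>A. fact (y i)) * fact (k - 1) / fact (sum y A + k - 1))"
    using insert.IH unfolding k_def by blast
  interpret M: prob_space M
    using mom[of "\<lambda>_. 0"] by (intro prob_spaceI) simp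
  define T :: "real \<times> ('i \<Rightarrow> real) \<Rightarrow> 'i \<Rightarrow> real"
    where "T = (\<lambda>(b, x) i. if i = a then b else (1 - b) * x i)"
  let ?S = "stick_measure k"
  interpret S: prob_space ?S
    using stick_measure_moment[OF k, of 0 0] k by (intro prob_spaceI) (simp add: fact_reduce)
  interpret pair_sigma_finite ?S M ..
  let ?P = "PiM UNIV (\<lambda>_::'i. borel :: real measure)"
  have coord[measurable]: "(\<lambda>x. x i) \<in> borel_measurable ?P" for i
    by measurable
  have [measurable]: "finite (insert a A)" using insert.hyps by simp
  have T_meas[measurable]: "T \<in> measurable (?S \<Otimes>\<^sub>M M) ?P"
  proof (rule measurable_PiM_single')
    fix i
    have "(\<lambda>p. T p i) = (\<lambda>p. if i = a then fst p else (1 - fst p) * snd p i)"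
      by (auto simp: T_def fun_eq_iff)
    moreover have "(\<lambda>x. x i) \<in> borel_measurable M" by measurable
    ultimately show "(\<lambda>p. T p i) \<in> borel_measurable (?S \<Otimes>\<^sub>M M)"
      by simp
  qed (auto simp: space_PiM)
  have AE_pair: "AE p in ?S \<Otimes>\<^sub>M M. P p"
    if [measurable]: "Measurable.pred (?S \<Otimes>\<^sub>M M) P" and "AE b in ?S. AE x in M. P (b, x)" for P
    using that(2) by (intro AE_pair_measure) auto
  let ?M = "distr (?S \<Otimes>\<^sub>M M) ?P T"
  show ?case
  proof (intro exI[of _ ?M] conjI allI)
    show "AE x in ?M. (\<forall>i\<in>insert a A. 0 < x i) \<and> sum x (insert a A) = 1"
    proof (subst AE_distr_iff)
      show "{x \<in> space ?P. (\<forall>i\<in>insert a A. 0 < x i) \<and> sum x (insert a A) = 1} \<in> sets ?P"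
        using insert.hyps(1) by measurable
      show "AE p in ?S \<Otimes>\<^sub>M M. (\<forall>i\<in>insert a A. 0 < T p i) \<and> sum (T p) (insert a A) = 1"
      proof (rule AE_pair)
        show "AE b in ?S. AE x in M. (\<forall>i\<in>insert a A. 0 < T (b, x) i) \<and> sum (T (b, x)) (insert a A) = 1"
          using AE_stick_measure
        proof eventually_elim
          case b: (elim b)
          show ?case using pos
          proof eventually_elim
            case (elim x)
            have "sum (T (b, x)) A = (\<Sum>i\<in>A. (1 - b) * x i)"
              using insert.hyps by (intro sum.cong) (auto simp: T_def)
            also have "\<dots> = 1 - b" using elim by (simp add: sum_distrib_left[symmetric])
            finally show ?case using insert.hyps elim b by (auto simp: T_def)
          qed
        qed
      qed (use insert.hyps(1) in measurable)
    qed fact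
    fix y :: "'i \<Rightarrow> nat"
    have "(\<integral>\<^sup>+x. ennreal (\<Prod>i\<in>insert a A. x i ^ y i) \<partial>?M)
      = (\<integral>\<^sup>+p. ennreal (\<Prod>i\<in>insert a A. T p i ^ y i) \<partial>(?S \<Otimes>\<^sub>M M))"
      by (subst nn_integral_distr) auto
    also have "\<dots> = (\<integral>\<^sup>+b. \<integral>\<^sup>+x. ennreal (\<Prod>i\<in>insert a A. T (b, x) i ^ y i) \<partial>M \<partial>?S)"
      by (subst M.nn_integral_fst[symmetric]) auto
    also have "\<dots> = (\<integral>\<^sup>+b. ennreal (b ^ y a * (1 - b) ^ sum y A) *
        ennreal ((\<Prod>i\<in>A. fact (y i)) * fact (k - 1) / fact (sum y A + k - 1)) \<partial>?S)"
    proof (rule nn_integral_cong_AE, use AE_stick_measure in eventually_elim)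
      case (elim b)
      have "(\<Prod>i\<in>insert a A. T (b, x) i ^ y i)
          = (b ^ y a * (1 - b) ^ sum y A) * (\<Prod>i\<in>A. x i ^ y i)" for x
      proof -
        have "(\<Prod>i\<in>A. T (b, x) i ^ y i) = (\<Prod>i\<in>A. (1 - b) ^ y i * x i ^ y i)"
          using insert.hyps by (intro prod.cong) (auto simp: T_def power_mult_distrib)
        then show ?thesis using insert.hyps
          by (simp add: T_def prod.distrib power_sum)
      qed
      then show ?case
        using elim mom[of y] by (simp add: ennreal_mult' nn_integral_cmult)
    qed
    also have "\<dots> = ennreal (real k * fact (y a) * fact (sum y A + k - 1) / fact (y a + sum y A + k)) *
        ennreal ((\<Prod>i\<in>A. fact (y i)) * fact (k - 1) / fact (sum y A + k - 1))"
      by (subst nn_integral_multc[OF stick_power_measurable]) (simp add: stick_measure_moment[OF k])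
    also have "\<dots> = ennreal ((\<Prod>i\<in>insert a A. fact (y i)) * fact (card (insert a A) - 1)
        / fact (sum y (insert a A) + card (insert a A) - 1))"
    proof -
      have "real k * fact (k - 1) = fact k" using k by (simp add: fact_reduce)
      then show ?thesis using insert.hyps
        by (simp add: ennreal_mult'[symmetric] prod_nonneg k_def[symmetric] mult_ac)
    qed
    finally show "(\<integral>\<^sup>+x. ennreal (\<Prod>i\<in>insert a A. x i ^ y i) \<partial>?M)
      = ennreal ((\<Prod>i\<in>insert a A. fact (y i)) * fact (card (insert a A) - 1)
        / fact (sum y (insert a A) + card (insert a A) - 1))" .
  qed simp
qed

text \<open>
  The uniform law, given by its support and its moments.  On the bounded simplex the moments determine it,
  and unlike a density they do not require a reference measure on a hyperplane.
\<close>

definition uniform_on_simplex :: "('n::finite \<Rightarrow> real) measure \<Rightarrow> bool" where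
  "uniform_on_simplex M \<longleftrightarrow>
    sets M = sets (PiM UNIV (\<lambda>_. borel)) \<and>
    (AE x in M. x \<in> positive_vectors \<and> (\<Sum>i\<in>UNIV. x i) = 1) \<and>
    (\<forall>y. has_bochner_integral M (\<lambda>x. \<Prod>i\<in>UNIV. x i ^ y i)
           ((\<Prod>i\<in>UNIV. fact (y i)) * fact (CARD('n) - 1) / fact ((\<Sum>i\<in>UNIV. y i) + CARD('n) - 1)))"

lemma uniform_on_simplex_exists: "\<exists>M :: ('n::finite \<Rightarrow> real) measure. uniform_on_simplex M"
proof -
  obtain M :: "('n \<Rightarrow> real) measure" where
    sets[measurable_cong]: "sets M = sets (PiM UNIV (\<lambda>_. borel))" and
    pos: "AE x in M. (\<forall>i\<in>UNIV. 0 < x i) \<and> sum x UNIV = 1" and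
    mom: "\<And>y. (\<integral>\<^sup>+x. ennreal (\<Prod>i\<in>UNIV. x i ^ y i) \<partial>M)
           = ennreal ((\<Prod>i\<in>UNIV. fact (y i)) * fact (CARD('n) - 1) / fact (sum y UNIV + CARD('n) - 1))"
    using uniform_simplex_measure_exists[of "UNIV :: 'n set"] by auto
  have "has_bochner_integral M (\<lambda>x. \<Prod>i\<in>UNIV. x i ^ y i)
          ((\<Prod>i\<in>UNIV. fact (y i)) * fact (CARD('n) - 1) / fact ((\<Sum>i\<in>UNIV. y i) + CARD('n) - 1))" for y
  proof (rule has_bochner_integral_nn_integral)
    show "AE x in M. 0 \<le> (\<Prod>i\<in>UNIV. x i ^ y i)"
      using pos by eventually_elim (auto intro!: prod_nonneg simp: less_imp_le)
  qed (auto simp: mom prod_nonneg)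
  then have "uniform_on_simplex M"
    using sets pos by (auto simp: uniform_on_simplex_def positive_vectors_def)
  then show ?thesis ..
qed

text \<open>
  The total mass is the moment for \<open>y = 0\<close>.
\<close>

lemma uniform_on_simplex_prob_space:
  assumes "uniform_on_simplex M"
  shows "prob_space M"
proof (rule prob_spaceI)
  have "has_bochner_integral M (\<lambda>x. 1) (1::real)"
    using assms unfolding uniform_on_simplex_def by (auto dest!: spec[of _ "\<lambda>_. 0"])
  then have "(\<integral>\<^sup>+x. ennreal 1 \<partial>M) = ennreal 1"
    by (intro nn_integral_eq_integral[THEN trans]) (auto simp: has_bochner_integral_iff)
  then show "emeasure M (space M) = 1" by simp
qed

lemma uniform_on_simplex_coordinate_measurable:
  "uniform_on_simplex M \<Longrightarrow> (\<lambda>x. x i) \<in> borel_measurable M"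
  unfolding uniform_on_simplex_def
  by (subst measurable_cong_sets[of M "PiM UNIV (\<lambda>_. borel)" borel borel]) auto

text \<open>
  Integrate the multinomial expansion of \<open>(\<Sum>i. x i) ^ z / fact z\<close>, which is constant on the
  simplex: each of its terms has the same integral, so that their number is determined.
  In other words, a uniform direction makes the count vector uniform on its level.
\<close>

lemma card_level:
  "real (card (level z :: ('n::finite \<Rightarrow> nat) set)) * (fact (CARD('n) - 1) / fact (z + CARD('n) - 1)) = 1 / fact z"
proof -
  obtain M :: "('n \<Rightarrow> real) measure" where M: "uniform_on_simplex M"
    using uniform_on_simplex_exists by blast
  interpret prob_space M by (rule uniform_on_simplex_prob_space[OF M])
  define m :: "('n \<Rightarrow> nat) \<Rightarrow> real" where "m y = (\<Prod>i\<in>UNIV. fact (y i)) * fact (CARD('n) - 1) / fact ((\<Sum>i\<in>UNIV. y i) + CARD('n) - 1)" for y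
  let ?f = "\<lambda>x. \<Sum>y\<in>level z. (\<Prod>i\<in>UNIV. x i ^ y i) * (1 / (\<Prod>i\<in>UNIV. fact (y i)))"
  have int: "has_bochner_integral M ?f (\<Sum>y\<in>level z. m y * (1 / (\<Prod>i\<in>UNIV. fact (y i))))"
    using M unfolding uniform_on_simplex_def m_def
    by (intro has_bochner_integral_sum has_bochner_integral_mult_left) auto
  have "AE x in M. x \<in> positive_vectors \<and> (\<Sum>i\<in>UNIV. x i) = 1"
    using M by (simp add: uniform_on_simplex_def)
  then have "AE x in M. ?f x = 1 / fact z"
  proof eventually_elim
    case (elim x)
    then have "(\<Sum>y\<in>level z. pmf (poisson_vector x) y) = exp (- 1) / fact z"
      by (simp add: pmf_level)
    moreover have "(\<Sum>y\<in>level z. pmf (poisson_vector x) y) = exp (- 1) * ?f x"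
      using elim by (simp add: pmf_poisson_vector sum_distrib_left)
    ultimately have "exp (- 1) * ?f x = exp (- 1) * (1 / fact z)" by simp
    then show ?case by (simp only: mult_cancel_left exp_not_eq_zero) simp
  qed
  then have "has_bochner_integral M ?f (1 / fact z)"
    using int by (subst has_bochner_integral_cong_AE[where g="\<lambda>_. 1 / fact z"])
      (auto simp: has_bochner_integral_iff prob_space)
  then have "1 / fact z = (\<Sum>y\<in>level z. m y * (1 / (\<Prod>i\<in>UNIV. fact (y i))))"
    using int by (rule has_bochner_integral_eq)
  also have "\<dots> = (\<Sum>y\<in>(level z :: ('n \<Rightarrow> nat) set). fact (CARD('n) - 1) / fact (z + CARD('n) - 1))"
    by (intro sum.cong) (auto simp: m_def level_def)
  finally show ?thesis by simp
qed

section \<open>Averaging the risk over directions\<close>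

text \<open>
  Probability of \<open>y\<close> times loss of the action \<open>a\<close>, at \<open>\<theta> = \<gamma> * x\<close>.  The probability is spelled
  out by its formula, and not as a \<open>pmf\<close>, in order to be measurable in \<open>x\<close> on all of space,
  also where \<open>x\<close> has negative entries.
\<close>

definition joint_loss :: "real \<Rightarrow> real \<Rightarrow> ('n::finite \<Rightarrow> real) \<Rightarrow> ('n \<Rightarrow> nat) \<Rightarrow> ('n \<Rightarrow> real) \<Rightarrow> real" where
  "joint_loss c \<gamma> a y x = exp (- \<gamma>) * (\<Prod>i\<in>UNIV. (\<gamma> * x i) ^ y i) / (\<Prod>i\<in>UNIV. fact (y i))
      * vector_loss c (\<lambda>i. \<gamma> * x i) a"

text \<open>
  The posterior risk at \<open>y\<close>.  Dividing a monomial by \<open>x i\<close> lowers the exponent \<open>y i\<close> by one, which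
  multiplies its integral by \<open>(z + p - 1) / y i\<close>.  For \<open>y i = 0\<close> the inverse moment is not of this form, whence
  the condition that \<open>a i\<close> vanishes there; division by zero then gives the right summand \<open>0\<close>.
\<close>

lemma integral_joint_loss:
  fixes a :: "'n::finite \<Rightarrow> real"
  assumes M: "uniform_on_simplex M" and c: "0 \<le> c" and \<gamma>: "0 < \<gamma>"
    and y: "y \<in> level z" and a: "\<And>i. y i = 0 \<Longrightarrow> a i = 0"
  defines "s \<equiv> \<Sum>i\<in>UNIV. a i"
  shows "(\<integral>\<^sup>+x. ennreal (joint_loss c \<gamma> a y x) \<partial>M) =
    ennreal (exp (- \<gamma>) * \<gamma> ^ z * (fact (CARD('n) - 1) / fact (z + CARD('n) - 1)) *
      ((real z + real CARD('n) - 1) * (\<Sum>i\<in>UNIV. (a i)\<^sup>2 / real (y i)) / \<gamma>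
        + (c * s\<^sup>2 / \<gamma> - 2 * (1 + c) * s + (1 + c) * \<gamma>)))"
proof -
  define p where "p = CARD('n)"
  have p: "0 < p" by (simp add: p_def)
  define m :: "('n \<Rightarrow> nat) \<Rightarrow> real" where "m y = (\<Prod>i\<in>UNIV. fact (y i)) * fact (p - 1) / fact ((\<Sum>i\<in>UNIV. y i) + p - 1)" for y
  define K where "K = exp (- \<gamma>) * \<gamma> ^ z / (\<Prod>i\<in>UNIV. fact (y i))"
  define C where "C = c * s\<^sup>2 / \<gamma> - 2 * (1 + c) * s + (1 + c) * \<gamma>"
  let ?X = "\<lambda>x y. \<Prod>i\<in>UNIV. x i ^ y i"
  define f where "f x = K * ((\<Sum>i\<in>UNIV. (a i)\<^sup>2 / \<gamma> * ?X x (y(i := y i - 1))) + C * ?X x y)" for x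
  have mom: "has_bochner_integral M (\<lambda>x. ?X x y) (m y)" for y
    using M unfolding uniform_on_simplex_def m_def p_def by blast
  have sum_y: "(\<Sum>i\<in>UNIV. y i) = z" using y by (simp add: level_def)
  \<comment> \<open>For \<open>y i = 0\<close> the exponent \<open>y i - 1\<close> is truncated, which is harmless because \<open>a i = 0\<close>.\<close>
  have m_dec: "(a i)\<^sup>2 / \<gamma> * m (y(i := y i - 1)) = m y * (real z + real p - 1) / \<gamma> * ((a i)\<^sup>2 / real (y i))" for i
  proof (cases "y i = 0")
    case False
    then obtain k where k: "y i = Suc k" by (cases "y i") auto
    have "z = Suc (sum y (UNIV - {i}) + k)"
      using sum_y k by (simp add: sum.remove[of UNIV i])
    then obtain l where l: "z = Suc l" "l = sum y (UNIV - {i}) + k" by blast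
    obtain r where r: "p = Suc r" using p by (cases p) auto
    have "(\<Prod>j\<in>UNIV. fact (y j) :: real) = real (y i) * (\<Prod>j\<in>UNIV. fact ((y(i := y i - 1)) j))"
      using k by (simp add: prod.remove[of UNIV i])
    moreover have "(\<Sum>j\<in>UNIV. (y(i := y i - 1)) j) = l"
      using k l by (simp add: sum.remove[of UNIV i])
    ultimately show ?thesis
      using False \<gamma> unfolding m_def sum_y
      by (simp add: l(1) r mult_ac del: fun_upd_apply)
  qed (simp add: a)
  have int: "has_bochner_integral M f (K * ((\<Sum>i\<in>UNIV. (a i)\<^sup>2 / \<gamma> * m (y(i := y i - 1))) + C * m y))"
    unfolding f_def
    by (intro has_bochner_integral_mult_right has_bochner_integral_add has_bochner_integral_sum mom)
  have AE: "AE x in M. x \<in> positive_vectors \<and> (\<Sum>i\<in>UNIV. x i) = 1"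
    using M by (simp add: uniform_on_simplex_def)
  have eq: "AE x in M. joint_loss c \<gamma> a y x = f x \<and> 0 \<le> f x"
    using AE
  proof eventually_elim
    case (elim x)
    then have pos: "0 < x i" for i by (auto simp: positive_vectors_def)
    have \<gamma>x: "(\<lambda>i. \<gamma> * x i) \<in> positive_vectors" "(\<Sum>i\<in>UNIV. \<gamma> * x i) = \<gamma>"
      using elim \<gamma> by (auto simp: positive_vectors_def sum_distrib_left[symmetric])
    have "(a i)\<^sup>2 / (\<gamma> * x i) * ?X x y = (a i)\<^sup>2 / \<gamma> * ?X x (y(i := y i - 1))" for i
    proof (cases "y i = 0")
      case False
      then have "?X x y = x i * ?X x (y(i := y i - 1))"
        by (cases "y i") (auto simp: prod.remove[of UNIV i])
      then show ?thesis using pos[of i] by (simp del: fun_upd_apply)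
    qed (simp add: a)
    then have "(\<Sum>i\<in>UNIV. (a i)\<^sup>2 / (\<gamma> * x i)) * ?X x y = (\<Sum>i\<in>UNIV. (a i)\<^sup>2 / \<gamma> * ?X x (y(i := y i - 1)))"
      by (simp only: sum_distrib_right)
    moreover have "exp (- \<gamma>) * (\<Prod>i\<in>UNIV. (\<gamma> * x i) ^ y i) / (\<Prod>i\<in>UNIV. fact (y i)) = K * ?X x y"
      by (simp add: K_def power_mult_distrib prod.distrib power_sum[symmetric] sum_y)
    moreover have "vector_loss c (\<lambda>i. \<gamma> * x i) a = (\<Sum>i\<in>UNIV. (a i)\<^sup>2 / (\<gamma> * x i)) + C"
      unfolding vector_loss_expand[OF \<gamma>x(1)] \<gamma>x(2) C_def s_def ..
    ultimately have "joint_loss c \<gamma> a y x = f x"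
      unfolding joint_loss_def f_def by (simp only: mult.assoc distrib_left) (simp only: mult_ac)
    moreover have "0 \<le> joint_loss c \<gamma> a y x"
      using vector_loss_nonneg[OF c \<gamma>x(1)] \<gamma> pos
      by (auto simp: joint_loss_def less_imp_le intro!: mult_nonneg_nonneg divide_nonneg_nonneg prod_nonneg)
    ultimately show ?case by simp
  qed
  have "(\<integral>\<^sup>+x. ennreal (joint_loss c \<gamma> a y x) \<partial>M) = (\<integral>\<^sup>+x. ennreal (f x) \<partial>M)"
    using eq by (intro nn_integral_cong_AE) auto
  also have "\<dots> = ennreal (integral\<^sup>L M f)"
    using int eq by (intro nn_integral_eq_integral) (auto simp: has_bochner_integral_iff)
  also have "integral\<^sup>L M f = K * ((\<Sum>i\<in>UNIV. (a i)\<^sup>2 / \<gamma> * m (y(i := y i - 1))) + C * m y)"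
    using int by (simp add: has_bochner_integral_iff)
  also have "\<dots> = K * m y * ((real z + real p - 1) * (\<Sum>i\<in>UNIV. (a i)\<^sup>2 / real (y i)) / \<gamma> + C)"
    unfolding m_dec sum_distrib_left[symmetric] by (simp add: algebra_simps)
  also have "K * m y = exp (- \<gamma>) * \<gamma> ^ z * (fact (p - 1) / fact (z + p - 1))"
    by (simp add: K_def m_def sum_y)
  finally show ?thesis by (simp add: C_def p_def)
qed

text \<open>
  Nonnegativity of the minimal posterior risk, so that \<open>ennreal\<close> does not truncate it.  The case
  \<open>w = 0\<close> is that of total count \<open>0\<close>, where both the weight and the estimate vanish.
\<close>

lemma quadratic_weight_nonneg:
  fixes \<gamma> w s :: real
  assumes "0 < \<gamma>" "0 \<le> w" "w \<le> 1" "w = 0 \<Longrightarrow> s = 0"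
  shows "0 \<le> s\<^sup>2 / (w * \<gamma>) - 2 * s + \<gamma>"
proof (cases "w = 0")
  case False
  have "0 \<le> (s - \<gamma>)\<^sup>2 / \<gamma>" using assms by simp
  also have "\<dots> = s\<^sup>2 / \<gamma> - 2 * s + \<gamma>" using assms by (simp add: field_simps power2_eq_square)
  also have "s\<^sup>2 / \<gamma> \<le> s\<^sup>2 / (w * \<gamma>)"
    using assms False by (intro divide_left_mono) (auto simp: mult_le_cancel_right1)
  finally show ?thesis by simp
qed (use assms in auto)

text \<open>
  Cauchy--Schwarz with weights \<open>y i\<close>; equality holds for \<open>a\<close> proportional to \<open>y\<close>, which is the form
  of the shrinkage estimator.
\<close>

lemma square_sum_le_weighted:
  fixes a :: "'n::finite \<Rightarrow> real"
  assumes y: "y \<in> level z" and a: "\<And>i. y i = 0 \<Longrightarrow> a i = 0"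
  shows "(\<Sum>i\<in>UNIV. a i)\<^sup>2 \<le> real z * (\<Sum>i\<in>UNIV. (a i)\<^sup>2 / real (y i))"
proof -
  have "(\<Sum>i\<in>UNIV. sqrt (real (y i)) * (a i / sqrt (real (y i))))\<^sup>2
     \<le> (\<Sum>i\<in>UNIV. (sqrt (real (y i)))\<^sup>2) * (\<Sum>i\<in>UNIV. (a i / sqrt (real (y i)))\<^sup>2)"
    by (rule Cauchy_Schwarz_ineq_sum)
  moreover have "sqrt (real (y i)) * (a i / sqrt (real (y i))) = a i" for i
    using a[of i] by (cases "y i = 0") auto
  moreover have "(\<Sum>i\<in>UNIV. real (y i)) = real z"
    using y by (auto simp: level_def simp flip: of_nat_sum)
  ultimately show ?thesis by (simp add: power_divide)
qed

text \<open>
  Two lower bounds are combined: at each \<open>y\<close> the posterior risk is at least the value that a vector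
  proportional to \<open>y\<close> with the same coordinate sum \<open>t y\<close> would have, and over the level the
  convex function \<open>h\<close> of \<open>t y\<close> is averaged with equal weights.
\<close>

lemma level_average_bound:
  fixes d :: "('n::finite \<Rightarrow> nat) \<Rightarrow> 'n \<Rightarrow> real"
  assumes M: "uniform_on_simplex M" and c: "0 \<le> c" and p: "2 \<le> CARD('n)" and \<gamma>: "0 < \<gamma>"
    and d: "\<And>y i. y i = 0 \<Longrightarrow> d y i = 0"
  defines "w \<equiv> shrink_weight c CARD('n)"
    and "s \<equiv> \<lambda>z. (\<Sum>y\<in>level z. \<Sum>i\<in>UNIV. d y i) / real (card (level z :: ('n \<Rightarrow> nat) set))"
  shows "ennreal (pmf (poisson_pmf \<gamma>) z) * (ennreal (1 + c) * ennreal ((s z)\<^sup>2 / (w z * \<gamma>) - 2 * s z + \<gamma>))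
       \<le> (\<Sum>y\<in>level z. \<integral>\<^sup>+x. ennreal (joint_loss c \<gamma> (d y) y x) \<partial>M)"
proof -
  define L where "L = (level z :: ('n \<Rightarrow> nat) set)"
  define N where "N = real (card L)"
  define K where "K = exp (- \<gamma>) * \<gamma> ^ z * (fact (CARD('n) - 1) / fact (z + CARD('n) - 1))"
  define t where "t y = (\<Sum>i\<in>UNIV. d y i)" for y
  define h where "h x = x\<^sup>2 / (w z * \<gamma>) - 2 * x + \<gamma>" for x
  have card: "N * (fact (CARD('n) - 1) / fact (z + CARD('n) - 1)) = 1 / fact z"
    unfolding N_def L_def by (rule card_level)
  then have N: "0 < N" by (cases "N = 0") (auto simp: N_def)
  have NK: "N * K = pmf (poisson_pmf \<gamma>) z"
  proof -
    have "N * K = exp (- \<gamma>) * \<gamma> ^ z * (N * (fact (CARD('n) - 1) / fact (z + CARD('n) - 1)))"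
      by (simp add: K_def)
    also note card
    finally show ?thesis using \<gamma> by simp
  qed
  have K: "0 \<le> K" using \<gamma> by (simp add: K_def)
  have w: "0 \<le> w z" "w z \<le> 1" "w z = 0 \<Longrightarrow> z = 0"
    using c p shrink_weight_pos[OF c p, of z]
    by (auto simp: w_def shrink_weight_nonneg shrink_weight_le_1)
  \<comment> \<open>At \<open>z = 0\<close> the weight is \<open>0\<close> and divisions by it yield \<open>0\<close>, consistently with \<open>t = 0\<close>.\<close>
  have t0: "t y = 0" if "z = 0" "y \<in> L" for y
    using that d by (simp add: t_def L_def level_0)
  have h_nonneg: "0 \<le> h (t y)" if "y \<in> L" for y
    unfolding h_def using w t0 that \<gamma> by (intro quadratic_weight_nonneg) auto
  have post: "ennreal (K * ((1 + c) * h (t y))) \<le> (\<integral>\<^sup>+x. ennreal (joint_loss c \<gamma> (d y) y x) \<partial>M)"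
    if y: "y \<in> L" for y
  proof -
    define Q where "Q = (\<Sum>i\<in>UNIV. (d y i)\<^sup>2 / real (y i))"
    have "(1 + c) * (t y)\<^sup>2 / w z \<le> (real z + real CARD('n) - 1) * Q + c * (t y)\<^sup>2"
    proof (cases "z = 0")
      case True
      then have "y i = 0" for i using y by (simp add: L_def level_0)
      then have "Q = 0" by (simp add: Q_def)
      then show ?thesis using True y t0 by (simp add: w_def)
    next
      case False
      have "(t y)\<^sup>2 \<le> real z * Q"
        unfolding t_def Q_def using y d by (intro square_sum_le_weighted) (auto simp: L_def)
      then have "(t y)\<^sup>2 / real z \<le> Q" using False by (simp add: field_simps)
      then have "(real z + real CARD('n) - 1) * ((t y)\<^sup>2 / real z) \<le> (real z + real CARD('n) - 1) * Q"
        using p by (intro mult_left_mono) auto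
      moreover have "(1 + c) * (t y)\<^sup>2 / w z = (t y)\<^sup>2 / real z * (real CARD('n) - 1 + (1 + c) * real z)"
        using c by (simp add: w_def shrink_weight_def)
      then have "(1 + c) * (t y)\<^sup>2 / w z = (real z + real CARD('n) - 1) * ((t y)\<^sup>2 / real z) + c * (t y)\<^sup>2"
        using False by (simp add: field_simps)
      ultimately show ?thesis by simp
    qed
    then have "(1 + c) * (t y)\<^sup>2 / w z / \<gamma> \<le> ((real z + real CARD('n) - 1) * Q + c * (t y)\<^sup>2) / \<gamma>"
      using \<gamma> by (intro divide_right_mono) auto
    then have "(1 + c) * h (t y) \<le> (real z + real CARD('n) - 1) * Q / \<gamma>
        + (c * (t y)\<^sup>2 / \<gamma> - 2 * (1 + c) * t y + (1 + c) * \<gamma>)"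
      by (simp add: h_def add_divide_distrib diff_divide_distrib algebra_simps)
    then have "K * ((1 + c) * h (t y)) \<le> K * ((real z + real CARD('n) - 1) * Q / \<gamma>
        + (c * (t y)\<^sup>2 / \<gamma> - 2 * (1 + c) * t y + (1 + c) * \<gamma>))"
      using K by (rule mult_left_mono)
    moreover have "(\<integral>\<^sup>+x. ennreal (joint_loss c \<gamma> (d y) y x) \<partial>M)
      = ennreal (K * ((real z + real CARD('n) - 1) * Q / \<gamma>
        + (c * (t y)\<^sup>2 / \<gamma> - 2 * (1 + c) * t y + (1 + c) * \<gamma>)))"
      unfolding K_def t_def Q_def
      by (rule integral_joint_loss[OF M c \<gamma> y[unfolded L_def]]) (rule d)
    ultimately show ?thesis by (simp only: ennreal_leI)
  qed
  have st: "(\<Sum>y\<in>L. t y) = N * s z"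
    using N by (simp add: s_def t_def L_def N_def)
  have "(N * s z)\<^sup>2 \<le> N * (\<Sum>y\<in>L. (t y)\<^sup>2)"
    using sum_squared_le_sum_of_squares[of t L] unfolding st by (simp only: N_def mult.commute)
  then have "N * (s z)\<^sup>2 \<le> (\<Sum>y\<in>L. (t y)\<^sup>2)"
    using N by (simp add: power2_eq_square mult_ac)
  then have "N * (s z)\<^sup>2 / (w z * \<gamma>) \<le> (\<Sum>y\<in>L. (t y)\<^sup>2) / (w z * \<gamma>)"
    using w \<gamma> by (intro divide_right_mono) auto
  moreover have "(\<Sum>y\<in>L. h (t y)) = (\<Sum>y\<in>L. (t y)\<^sup>2) / (w z * \<gamma>) - 2 * (N * s z) + N * \<gamma>"
    by (simp add: h_def sum.distrib sum_subtractf sum_distrib_left[symmetric] st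
        sum_divide_distrib[symmetric] N_def)
  ultimately have "N * h (s z) \<le> (\<Sum>y\<in>L. h (t y))"
    by (simp add: h_def algebra_simps)
  then have "K * ((1 + c) * (N * h (s z))) \<le> K * ((1 + c) * (\<Sum>y\<in>L. h (t y)))"
    using K c by (intro mult_left_mono) auto
  then have "pmf (poisson_pmf \<gamma>) z * ((1 + c) * h (s z)) \<le> (\<Sum>y\<in>L. K * ((1 + c) * h (t y)))"
    by (simp add: NK[symmetric] sum_distrib_left mult_ac)
  then have "ennreal (pmf (poisson_pmf \<gamma>) z * ((1 + c) * h (s z))) \<le> (\<Sum>y\<in>L. ennreal (K * ((1 + c) * h (t y))))"
    using K c h_nonneg by (subst sum_ennreal) (auto intro: ennreal_leI)
  also have "\<dots> \<le> (\<Sum>y\<in>L. \<integral>\<^sup>+x. ennreal (joint_loss c \<gamma> (d y) y x) \<partial>M)"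
    by (rule sum_mono[OF post])
  finally show ?thesis
    using c by (simp add: h_def L_def ennreal_mult' del: ennreal_plus)
qed

text \<open>
  Any estimator whose risk stays below the constant \<open>G\<close> on the whole simplex of size \<open>\<gamma>\<close> gives rise
  to a function \<open>s\<close> of the total count, the average coordinate sum, that inherits the bound.
\<close>

lemma averaged_risk_strict:
  fixes d :: "('n::finite \<Rightarrow> nat) \<Rightarrow> 'n \<Rightarrow> real"
  assumes c: "0 \<le> c" and p: "2 \<le> CARD('n)" and \<gamma>: "0 < \<gamma>"
    and d: "\<And>y i. y i = 0 \<Longrightarrow> d y i = 0"
    and G: "G < \<infinity>"
    and less: "\<And>\<theta>. \<theta> \<in> positive_vectors \<Longrightarrow> (\<Sum>i\<in>UNIV. \<theta> i) = \<gamma> \<Longrightarrow>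
                 risk poisson_vector (vector_loss c) d \<theta> < G"
  defines "w \<equiv> shrink_weight c CARD('n)"
    and "s \<equiv> \<lambda>z. (\<Sum>y\<in>level z. \<Sum>i\<in>UNIV. d y i) / real (card (level z :: ('n \<Rightarrow> nat) set))"
  shows "ennreal (1 + c) * (\<integral>\<^sup>+z. ennreal ((s z)\<^sup>2 / (w z * \<gamma>) - 2 * s z + \<gamma>) \<partial>poisson_pmf \<gamma>) < G"
proof -
  obtain M :: "('n \<Rightarrow> real) measure" where M: "uniform_on_simplex M"
    using uniform_on_simplex_exists by blast
  interpret prob_space M by (rule uniform_on_simplex_prob_space[OF M])
  note [measurable] = uniform_on_simplex_coordinate_measurable[OF M]
  have [measurable]: "(\<lambda>x. joint_loss c \<gamma> a y x) \<in> borel_measurable M" for a y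
    unfolding joint_loss_def vector_loss_def by measurable
  let ?f = "\<lambda>x. \<Sum>z. \<Sum>y\<in>level z. ennreal (joint_loss c \<gamma> (d y) y x)"
  have "AE x in M. x \<in> positive_vectors \<and> (\<Sum>i\<in>UNIV. x i) = 1"
    using M by (simp add: uniform_on_simplex_def)
  \<comment> \<open>On the simplex \<open>?f\<close> is the risk at \<open>\<gamma> * x\<close>, written so as to be measurable everywhere.\<close>
  then have AE: "AE x in M. ?f x < G"
  proof eventually_elim
    case (elim x)
    let ?\<theta> = "\<lambda>i. \<gamma> * x i"
    have \<theta>: "?\<theta> \<in> positive_vectors" and sum: "(\<Sum>i\<in>UNIV. ?\<theta> i) = \<gamma>"
      using elim \<gamma> by (auto simp: positive_vectors_def sum_distrib_left[symmetric])
    have "joint_loss c \<gamma> a y x = pmf (poisson_vector ?\<theta>) y * vector_loss c ?\<theta> a" for a y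
      by (simp add: joint_loss_def pmf_poisson_vector[OF \<theta>] sum)
    then have "?f x = risk poisson_vector (vector_loss c) d ?\<theta>"
      unfolding risk_def nn_integral_by_level by (simp add: ennreal_mult')
    then show ?case using less[OF \<theta> sum] by simp
  qed
  have "ennreal (1 + c) * (\<integral>\<^sup>+z. ennreal ((s z)\<^sup>2 / (w z * \<gamma>) - 2 * s z + \<gamma>) \<partial>poisson_pmf \<gamma>)
      = (\<Sum>z. ennreal (pmf (poisson_pmf \<gamma>) z) * (ennreal (1 + c) * ennreal ((s z)\<^sup>2 / (w z * \<gamma>) - 2 * s z + \<gamma>)))"
    by (subst nn_integral_cmult[symmetric]) (auto simp: nn_integral_pmf_nat)
  also have "\<dots> \<le> (\<Sum>z. \<Sum>y\<in>level z. \<integral>\<^sup>+x. ennreal (joint_loss c \<gamma> (d y) y x) \<partial>M)"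
    unfolding w_def s_def
    by (intro suminf_le level_average_bound[OF M c p \<gamma> d]) auto
  also have "\<dots> = (\<integral>\<^sup>+x. ?f x \<partial>M)"
    by (subst nn_integral_suminf) (auto simp: nn_integral_sum)
  also have "\<dots> < (\<integral>\<^sup>+x. G \<partial>M)"
  proof (rule nn_integral_less)
    have "(\<integral>\<^sup>+x. ?f x \<partial>M) \<le> (\<integral>\<^sup>+x. G \<partial>M)"
      using AE by (intro nn_integral_mono_AE) (auto elim: eventually_mono)
    then show "(\<integral>\<^sup>+x. ?f x \<partial>M) \<noteq> \<infinity>" using G by (auto simp: emeasure_space_1 top_unique)
    show "\<not> (AE x in M. G \<le> ?f x)"
    proof
      assume "AE x in M. G \<le> ?f x"
      with AE have "AE x in M. False" by eventually_elim auto
      then show False by simp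
    qed
  qed (use AE in \<open>auto elim: eventually_mono\<close>)
  finally show ?thesis by (simp add: emeasure_space_1)
qed

section \<open>Consequences of bounded risk near the boundary\<close>

text \<open>
  With the sum \<open>\<gamma>\<close> kept fixed, \<open>\<theta> i\<close> is sent to \<open>0\<close> and the rest of \<open>\<gamma>\<close> is spread evenly over the other
  coordinates, of which there is at least one because \<open>p \<ge> 2\<close>.  As \<open>y i = 0\<close>, the probability of
  \<open>y\<close> stays bounded away from \<open>0\<close>, while the loss in coordinate \<open>i\<close> would be unbounded.
\<close>

lemma bounded_risk_zero_coordinate:
  fixes d :: "('n::finite \<Rightarrow> nat) \<Rightarrow> 'n \<Rightarrow> real"
  assumes c: "0 \<le> c" and p: "2 \<le> CARD('n)" and \<gamma>: "0 < \<gamma>" and "0 \<le> B"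
    and bound: "\<And>\<theta>. \<theta> \<in> positive_vectors \<Longrightarrow> (\<Sum>i\<in>UNIV. \<theta> i) = \<gamma> \<Longrightarrow>
                  risk poisson_vector (vector_loss c) d \<theta> \<le> ennreal B"
    and y: "y i = 0"
  shows "d y i = 0"
proof (rule eq_0_if_square_bound_near_0)
  define q where "q = real CARD('n) - 1"
  have q: "0 < q" using p by (simp add: q_def)
  \<comment> \<open>For \<open>t \<le> \<gamma> / 2\<close> every other coordinate of \<open>\<theta>\<close> is at least \<open>\<eta>\<close>.\<close>
  define \<eta> where "\<eta> = \<gamma> / (2 * q)"
  have \<eta>: "0 < \<eta>" using \<gamma> q by (simp add: \<eta>_def)
  define b where "b = exp (- \<gamma>) * (\<Prod>j\<in>UNIV. \<eta> ^ y j) / (\<Prod>j\<in>UNIV. fact (y j))"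
  show "0 < b" using \<eta> by (auto simp: b_def intro!: divide_pos_pos mult_pos_pos prod_pos)
  show "0 < \<gamma> / 2" using \<gamma> by simp
  fix t assume t: "0 < t" "t \<le> \<gamma> / 2"
  define \<theta> where "\<theta> j = (if j = i then t else (\<gamma> - t) / q)" for j
  have \<theta>: "\<theta> \<in> positive_vectors" using t q \<gamma> by (auto simp: positive_vectors_def \<theta>_def)
  have "(\<Sum>j\<in>UNIV. \<theta> j) = t + (\<Sum>j\<in>UNIV - {i}. (\<gamma> - t) / q)"
    by (subst sum.remove[of UNIV i]) (auto simp: \<theta>_def)
  also have "\<dots> = \<gamma>" using q p by (simp add: q_def of_nat_diff)
  finally have sum: "(\<Sum>j\<in>UNIV. \<theta> j) = \<gamma>" .
  have "\<eta> \<le> (\<gamma> - t) / q" using t q by (simp add: \<eta>_def field_simps)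
  then have "(\<Prod>j\<in>UNIV. \<eta> ^ y j) \<le> (\<Prod>j\<in>UNIV. \<theta> j ^ y j)"
    using \<eta> y by (intro prod_mono) (auto simp: \<theta>_def intro!: power_mono)
  then have b_le: "b \<le> pmf (poisson_vector \<theta>) y"
    unfolding pmf_poisson_vector[OF \<theta>] sum b_def
    by (intro divide_right_mono mult_left_mono) (auto intro: prod_nonneg)
  have pos: "0 < \<theta> j" for j using \<theta> by (auto simp: positive_vectors_def)
  have "(d y i - t)\<^sup>2 / t = (d y i - \<theta> i)\<^sup>2 / \<theta> i" by (simp add: \<theta>_def)
  also have "\<dots> \<le> (\<Sum>j\<in>UNIV. (d y j - \<theta> j)\<^sup>2 / \<theta> j)"
    by (rule member_le_sum) (auto simp: less_imp_le[OF pos])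
  also have "\<dots> \<le> vector_loss c \<theta> (d y)"
    using c \<gamma> unfolding vector_loss_def sum by simp
  finally have "b * ((d y i - t)\<^sup>2 / t) \<le> pmf (poisson_vector \<theta>) y * vector_loss c \<theta> (d y)"
    using b_le t by (intro mult_mono) auto
  also have "ennreal \<dots> \<le> ennreal B"
    using point_loss_le_risk[of poisson_vector \<theta> y "vector_loss c" d] bound[OF \<theta> sum]
      vector_loss_nonneg[OF c \<theta>, of "d y"]
    by (simp add: ennreal_mult')
  then have "pmf (poisson_vector \<theta>) y * vector_loss c \<theta> (d y) \<le> B"
    using \<open>0 \<le> B\<close> by (simp add: ennreal_le_iff)
  finally show "b * ((d y i - t)\<^sup>2 / t) \<le> B" .
qed

text \<open>
  For \<open>z > 0\<close> the factor \<open>1 / \<gamma>\<close> of the loss cancels against \<open>\<gamma> ^ z\<close>, so that the terms are bounded in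
  terms of those at \<open>\<gamma>0\<close>; for \<open>z = 0\<close> the loss is \<open>\<gamma>\<close> itself because \<open>\<kappa> 0 = 0\<close>.
\<close>

lemma scalar_risk_bounded_near_0:
  assumes "\<kappa> 0 = 0" "0 < \<gamma>" "\<gamma> \<le> \<gamma>0"
  shows "risk poisson_pmf scalar_loss \<kappa> \<gamma>
       \<le> ennreal (exp \<gamma>0) * (ennreal 2 * risk poisson_pmf scalar_loss \<kappa> \<gamma>0 + ennreal (2 * \<gamma>0))"
proof -
  have \<gamma>0: "0 < \<gamma>0" using assms by simp
  have pt: "pmf (poisson_pmf \<gamma>) z * scalar_loss \<gamma> (\<kappa> z)
      \<le> pmf (poisson_pmf \<gamma>0) z * (exp \<gamma>0 * (2 * scalar_loss \<gamma>0 (\<kappa> z) + 2 * \<gamma>0))" for z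
  proof (cases z)
    case 0
    have "exp (- \<gamma>) * \<gamma> \<le> 1 * (4 * \<gamma>0)" using assms by (intro mult_mono) auto
    also have "\<dots> = exp (- \<gamma>0) * (exp \<gamma>0 * (4 * \<gamma>0))" by (simp add: exp_minus)
    finally show ?thesis using 0 assms \<gamma>0 by (simp add: scalar_loss_def power2_eq_square)
  next
    case (Suc k)
    \<comment> \<open>Parallelogram law, to replace the centre \<open>\<gamma>\<close> by \<open>\<gamma>0\<close>.\<close>
    have "(\<kappa> z - \<gamma>)\<^sup>2 + (\<kappa> z - \<gamma>0 - (\<gamma>0 - \<gamma>))\<^sup>2 = 2 * (\<kappa> z - \<gamma>0)\<^sup>2 + 2 * (\<gamma>0 - \<gamma>)\<^sup>2"
      by (simp add: power2_eq_square algebra_simps)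
    then have "(\<kappa> z - \<gamma>)\<^sup>2 \<le> 2 * (\<kappa> z - \<gamma>0)\<^sup>2 + 2 * (\<gamma>0 - \<gamma>)\<^sup>2"
      using zero_le_power2[of "\<kappa> z - \<gamma>0 - (\<gamma>0 - \<gamma>)"] by linarith
    also have "(\<gamma>0 - \<gamma>)\<^sup>2 \<le> \<gamma>0\<^sup>2" using assms by (intro power_mono) auto
    finally have sq: "(\<kappa> z - \<gamma>)\<^sup>2 \<le> 2 * (\<kappa> z - \<gamma>0)\<^sup>2 + 2 * \<gamma>0\<^sup>2" by simp
    have "exp (- \<gamma>) * \<gamma> ^ k * (\<kappa> z - \<gamma>)\<^sup>2 \<le> 1 * \<gamma>0 ^ k * (2 * (\<kappa> z - \<gamma>0)\<^sup>2 + 2 * \<gamma>0\<^sup>2)"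
      using assms sq by (intro mult_mono power_mono) auto
    then have "exp (- \<gamma>) * \<gamma> ^ k * (\<kappa> z - \<gamma>)\<^sup>2 / fact z
        \<le> 1 * \<gamma>0 ^ k * (2 * (\<kappa> z - \<gamma>0)\<^sup>2 + 2 * \<gamma>0\<^sup>2) / fact z"
      by (rule divide_right_mono) simp
    moreover have "exp (- \<gamma>) * \<gamma> ^ k * (\<kappa> z - \<gamma>)\<^sup>2 / fact z = pmf (poisson_pmf \<gamma>) z * scalar_loss \<gamma> (\<kappa> z)"
      using assms by (simp add: Suc scalar_loss_def mult_ac)
    moreover have "1 * \<gamma>0 ^ k * (2 * (\<kappa> z - \<gamma>0)\<^sup>2 + 2 * \<gamma>0\<^sup>2) / fact z
        = pmf (poisson_pmf \<gamma>0) z * (exp \<gamma>0 * (2 * scalar_loss \<gamma>0 (\<kappa> z) + 2 * \<gamma>0))"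
    proof -
      have "pmf (poisson_pmf \<gamma>0) z * exp \<gamma>0 = \<gamma>0 ^ k * \<gamma>0 / fact z"
        using \<gamma>0 by (simp add: Suc exp_minus mult_ac)
      moreover have "\<gamma>0 * (2 * scalar_loss \<gamma>0 (\<kappa> z) + 2 * \<gamma>0) = 2 * (\<kappa> z - \<gamma>0)\<^sup>2 + 2 * \<gamma>0\<^sup>2"
        using \<gamma>0 by (simp add: scalar_loss_def distrib_left power2_eq_square)
      ultimately show ?thesis by (metis mult.assoc mult_1 times_divide_eq_left)
    qed
    ultimately show ?thesis by simp
  qed
  have "risk poisson_pmf scalar_loss \<kappa> \<gamma> = (\<Sum>z. ennreal (pmf (poisson_pmf \<gamma>) z * scalar_loss \<gamma> (\<kappa> z)))"
    by (simp add: risk_def nn_integral_pmf_nat ennreal_mult' del: pmf_poisson)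
  also have "\<dots> \<le> (\<Sum>z. ennreal (pmf (poisson_pmf \<gamma>0) z * (exp \<gamma>0 * (2 * scalar_loss \<gamma>0 (\<kappa> z) + 2 * \<gamma>0))))"
    by (intro suminf_le ennreal_leI pt) auto
  also have "\<dots> = (\<integral>\<^sup>+z. ennreal (exp \<gamma>0) * (ennreal 2 * ennreal (scalar_loss \<gamma>0 (\<kappa> z)) + ennreal (2 * \<gamma>0)) \<partial>poisson_pmf \<gamma>0)"
    using \<gamma>0 scalar_loss_nonneg[OF \<gamma>0]
    by (simp only: nn_integral_pmf_nat ennreal_mult' ennreal_plus pmf_nonneg exp_ge_zero
        zero_le_numeral mult_nonneg_nonneg less_imp_le)
  also have "\<dots> = ennreal (exp \<gamma>0) * (ennreal 2 * risk poisson_pmf scalar_loss \<kappa> \<gamma>0 + ennreal (2 * \<gamma>0))"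
    unfolding risk_def by (subst nn_integral_cmult, simp, subst nn_integral_add, simp, simp, subst nn_integral_cmult)
      (auto simp: measure_pmf.emeasure_space_1)
  finally show ?thesis .
qed

section \<open>Transfer of admissibility\<close>

text \<open>
  From an improvement \<open>d\<close> of the shrinkage estimator the scalar estimator \<open>\<kappa>' = \<kappa> + (s - w * \<kappa>)\<close> is
  formed, where \<open>s\<close> is the average coordinate sum of \<open>d\<close> and \<open>w * \<kappa>\<close> that of the shrinkage
  estimator.  Its gain in scalar loss is at least the gain of \<open>s\<close> in weighted loss.
\<close>

lemma admissible_shrinkage_if_admissible_scalar:
  assumes c: "0 \<le> c" and p: "2 \<le> CARD('n::finite)"
    and adm: "admissible {0<..} poisson_pmf scalar_loss \<kappa>"
  shows "admissible (positive_vectors :: ('n \<Rightarrow> real) set) poisson_vector (vector_loss c)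
           (shrinkage_estimator c \<kappa>)"
  unfolding admissible_def
proof
  let ?V = "positive_vectors :: ('n \<Rightarrow> real) set"
  let ?R = "risk poisson_vector (vector_loss c) :: (('n \<Rightarrow> nat) \<Rightarrow> 'n \<Rightarrow> real) \<Rightarrow> _"
  let ?\<delta> = "shrinkage_estimator c \<kappa> :: ('n \<Rightarrow> nat) \<Rightarrow> 'n \<Rightarrow> real"
  let ?r = "risk poisson_pmf scalar_loss"
  define w where "w = shrink_weight c CARD('n)"
  assume "\<exists>d. dominates ?V poisson_vector (vector_loss c) d ?\<delta>"
  then obtain d0 where d0: "dominates ?V poisson_vector (vector_loss c) d0 ?\<delta>" by blast
  obtain d where d: "\<And>\<theta>. \<theta> \<in> ?V \<Longrightarrow> ?R ?\<delta> \<theta> < \<infinity> \<Longrightarrow> ?R d \<theta> < ?R ?\<delta> \<theta>"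
    by (rule strict_improvement[where m="\<lambda>a b i. (a i + b i) / 2",
          OF d0 set_pmf_poisson_vector vector_loss_nonneg[OF c] _ vector_loss_midpoint[OF c]]) auto
  define g where "g \<gamma> z = w z * ((\<kappa> z - \<gamma>)\<^sup>2 / \<gamma>) + (1 - w z) * \<gamma>" for \<gamma> z
  define G where "G \<gamma> = ennreal (1 + c) * (\<integral>\<^sup>+z. ennreal (g \<gamma> z) \<partial>poisson_pmf \<gamma>)" for \<gamma>
  have risk_\<delta>: "?R ?\<delta> \<theta> = G (\<Sum>i\<in>UNIV. \<theta> i)" if "\<theta> \<in> ?V" for \<theta>
    unfolding G_def g_def w_def by (rule shrinkage_risk[OF c p that])
  have G_fin: "G \<gamma> < \<infinity>" if "0 < \<gamma>" "?r \<kappa> \<gamma> < \<infinity>" for \<gamma>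
    using weighted_risk_finite[OF c p that]
    by (simp add: G_def g_def w_def ennreal_mult_less_top)
  have d_less: "?R d \<theta> < G \<gamma>" if "\<theta> \<in> ?V" "(\<Sum>i\<in>UNIV. \<theta> i) = \<gamma>" "?r \<kappa> \<gamma> < \<infinity>" for \<theta> \<gamma>
    using d[OF that(1)] G_fin[of \<gamma>] sum_pos_vector[OF that(1)] that by (simp add: risk_\<delta>)
  obtain \<gamma>0 where \<gamma>0: "0 < \<gamma>0" "?r \<kappa> \<gamma>0 < \<infinity>"
    using scalar_risk_finite_somewhere[OF adm] by blast
  have d_zero: "d y i = 0" if "y i = 0" for y i
  proof (rule bounded_risk_zero_coordinate[where d=d and y=y and i=i, OF c p \<gamma>0(1) enn2real_nonneg _ that])
    fix \<theta> assume "\<theta> \<in> ?V" "(\<Sum>i\<in>UNIV. \<theta> i) = \<gamma>0"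
    then show "?R d \<theta> \<le> ennreal (enn2real (G \<gamma>0))"
      using d_less[of \<theta> \<gamma>0] G_fin[OF \<gamma>0] \<gamma>0 by simp
  qed
  define s where "s z = (\<Sum>y\<in>level z. \<Sum>i\<in>UNIV. d y i) / real (card (level z :: ('n \<Rightarrow> nat) set))" for z
  define \<kappa>' where "\<kappa>' z = \<kappa> z + (s z - w z * \<kappa> z)" for z
  have s0: "s 0 = 0" by (simp add: s_def level_0 d_zero)
  have less: "?r \<kappa>' \<gamma> < ?r \<kappa> \<gamma>" if \<gamma>: "0 < \<gamma>" and fin: "?r \<kappa> \<gamma> < \<infinity>" for \<gamma>
  proof -
    define h where "h z = (s z)\<^sup>2 / (w z * \<gamma>) - 2 * s z + \<gamma>" for z
    have wz: "0 \<le> w z" "w z \<le> 1" for z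
      using shrink_weight_le_1[OF c p, of z] shrink_weight_nonneg[OF c p, of z] by (auto simp: w_def)
    have h0: "0 \<le> h z" for z
      unfolding h_def using \<gamma> wz s0 shrink_weight_pos[OF c p, of z]
      by (intro quadratic_weight_nonneg) (auto simp: w_def)
    have g0: "0 \<le> g \<gamma> z" for z
      unfolding g_def using \<gamma> wz[of z] by (intro add_nonneg_nonneg mult_nonneg_nonneg) auto
    have "ennreal (1 + c) * (\<integral>\<^sup>+z. ennreal (h z) \<partial>poisson_pmf \<gamma>) < G \<gamma>"
      unfolding h_def s_def w_def
      by (rule averaged_risk_strict[OF c p \<gamma> d_zero G_fin[OF \<gamma> fin] d_less]) (use fin in auto)
    then have hg: "(\<integral>\<^sup>+z. ennreal (h z) \<partial>poisson_pmf \<gamma>) < (\<integral>\<^sup>+z. ennreal (g \<gamma> z) \<partial>poisson_pmf \<gamma>)"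
      unfolding G_def by (rule contrapos_pp) (simp add: not_less mult_left_mono)
    \<comment> \<open>The two sides differ by \<open>e\<^sup>2 * (1 / w z - 1) / \<gamma>\<close>; adding terms avoids subtraction in \<open>ennreal\<close>.\<close>
    have pt: "scalar_loss \<gamma> (\<kappa>' z) + g \<gamma> z \<le> scalar_loss \<gamma> (\<kappa> z) + h z" for z
    proof (cases "z = 0")
      case True
      then show ?thesis by (simp add: \<kappa>'_def g_def h_def s0 w_def)
    next
      case False
      have w: "0 < w z" using shrink_weight_pos[OF c p] False by (simp add: w_def)
      define e where "e = s z - w z * \<kappa> z"
      have s: "s z = w z * \<kappa> z + e" by (simp add: e_def)
      have "scalar_loss \<gamma> (\<kappa> z) + h z - (scalar_loss \<gamma> (\<kappa>' z) + g \<gamma> z) = e\<^sup>2 * (1 - w z) / (w z * \<gamma>)"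
        using w \<gamma> unfolding scalar_loss_def \<kappa>'_def g_def h_def e_def[symmetric] s
        by (simp add: field_simps power2_eq_square)
      moreover have "0 \<le> e\<^sup>2 * (1 - w z) / (w z * \<gamma>)"
        using w wz[of z] \<gamma> by simp
      ultimately show ?thesis by linarith
    qed
    have "?r \<kappa>' \<gamma> + (\<integral>\<^sup>+z. ennreal (g \<gamma> z) \<partial>poisson_pmf \<gamma>)
        = (\<integral>\<^sup>+z. ennreal (scalar_loss \<gamma> (\<kappa>' z) + g \<gamma> z) \<partial>poisson_pmf \<gamma>)"
      using scalar_loss_nonneg[OF \<gamma>] g0 by (simp add: risk_def nn_integral_add)
    also have "\<dots> \<le> (\<integral>\<^sup>+z. ennreal (scalar_loss \<gamma> (\<kappa> z) + h z) \<partial>poisson_pmf \<gamma>)"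
      by (intro nn_integral_mono ennreal_leI pt)
    also have "\<dots> = ?r \<kappa> \<gamma> + (\<integral>\<^sup>+z. ennreal (h z) \<partial>poisson_pmf \<gamma>)"
      using scalar_loss_nonneg[OF \<gamma>] h0 by (simp add: risk_def nn_integral_add)
    finally show ?thesis using hg fin by (rule ennreal_less_of_add_le)
  qed
  then have "dominates {0<..} poisson_pmf scalar_loss \<kappa>' \<kappa>"
    unfolding dominates_def using \<gamma>0
    by (metis greaterThan_iff infinity_ennreal_def less_imp_le less_top top_greatest)
  then show False using adm by (auto simp: admissible_def)
qed

text \<open>
  From an improvement \<open>k\<close> of \<open>\<kappa>\<close> the shrinkage estimator for \<open>\<kappa>' = \<kappa> + w 1 * (k - \<kappa>) / w\<close> is formed.
  Dividing by \<open>w\<close> makes the terms linear in \<open>k - \<kappa>\<close> the same multiple of those in the scalar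
  loss for all counts, and the step size \<open>w 1\<close> is small enough for the quadratic terms.
\<close>

lemma admissible_scalar_if_admissible_shrinkage:
  assumes c: "0 \<le> c" and p: "2 \<le> CARD('n::finite)" and \<kappa>0: "\<kappa> 0 = 0"
    and adm: "admissible (positive_vectors :: ('n \<Rightarrow> real) set) poisson_vector (vector_loss c)
                (shrinkage_estimator c \<kappa>)"
  shows "admissible {0<..} poisson_pmf scalar_loss \<kappa>"
  unfolding admissible_def
proof
  let ?V = "positive_vectors :: ('n \<Rightarrow> real) set"
  let ?R = "risk poisson_vector (vector_loss c) :: (('n \<Rightarrow> nat) \<Rightarrow> 'n \<Rightarrow> real) \<Rightarrow> _"
  let ?\<delta> = "\<lambda>\<kappa>. shrinkage_estimator c \<kappa> :: ('n \<Rightarrow> nat) \<Rightarrow> 'n \<Rightarrow> real"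
  let ?r = "risk poisson_pmf scalar_loss"
  define w where "w = shrink_weight c CARD('n)"
  have wz: "0 \<le> w z" "w z \<le> 1" for z
    using shrink_weight_le_1[OF c p, of z] shrink_weight_nonneg[OF c p, of z] by (auto simp: w_def)
  have w1: "0 < w 1" using shrink_weight_pos[OF c p, of 1] by (simp add: w_def)
  assume "\<exists>k. dominates {0<..} poisson_pmf scalar_loss k \<kappa>"
  then obtain k0 where k0: "dominates {0<..} poisson_pmf scalar_loss k0 \<kappa>" by blast
  obtain k where k: "\<And>\<gamma>. \<gamma> \<in> {0<..} \<Longrightarrow> ?r \<kappa> \<gamma> < \<infinity> \<Longrightarrow> ?r k \<gamma> < ?r \<kappa> \<gamma>"
    by (rule strict_improvement[where m="\<lambda>a b. (a + b) / 2",
          OF k0 _ scalar_loss_nonneg _ scalar_loss_midpoint]) auto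
  define g where "g \<kappa> \<gamma> z = w z * ((\<kappa> z - \<gamma>)\<^sup>2 / \<gamma>) + (1 - w z) * \<gamma>" for \<kappa> \<gamma> z
  define G where "G \<kappa> \<gamma> = (\<integral>\<^sup>+z. ennreal (g \<kappa> \<gamma> z) \<partial>poisson_pmf \<gamma>)" for \<kappa> \<gamma>
  have risk_\<delta>: "?R (?\<delta> \<kappa>) \<theta> = ennreal (1 + c) * G \<kappa> (\<Sum>i\<in>UNIV. \<theta> i)" if "\<theta> \<in> ?V" for \<theta> \<kappa>
    unfolding G_def g_def w_def by (rule shrinkage_risk[OF c p that])
  have G_fin: "G \<kappa> \<gamma> < \<infinity>" if "0 < \<gamma>" "?r \<kappa> \<gamma> < \<infinity>" for \<gamma>
    using weighted_risk_finite[OF c p that] by (simp add: G_def g_def w_def)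
  have r_fin: "?r \<kappa> \<gamma> < \<infinity>" if "0 < \<gamma>" "G \<kappa> \<gamma> < \<infinity>" for \<gamma>
  proof -
    have "ennreal (w 1) * ?r \<kappa> \<gamma> \<le> G \<kappa> \<gamma>"
      unfolding G_def g_def w_def by (rule scalar_risk_le_weighted[where \<kappa>=\<kappa>, OF c p that(1) \<kappa>0])
    then have "ennreal (w 1) * ?r \<kappa> \<gamma> < \<infinity>" using that(2) by (rule le_less_trans)
    then show ?thesis using w1 by (auto simp: ennreal_mult_less_top)
  qed
  obtain \<theta>0 where \<theta>0: "\<theta>0 \<in> ?V" "?R (?\<delta> \<kappa>) \<theta>0 < \<infinity>"
    using vector_risk_finite_somewhere[OF adm] by blast
  define \<gamma>0 where "\<gamma>0 = (\<Sum>i\<in>UNIV. \<theta>0 i)"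
  have \<gamma>0: "0 < \<gamma>0" unfolding \<gamma>0_def by (rule sum_pos_vector[OF \<theta>0(1)])
  have "G \<kappa> \<gamma>0 < \<infinity>" using \<theta>0 c by (auto simp: risk_\<delta> \<gamma>0_def ennreal_mult_less_top)
  then have fin0: "?r \<kappa> \<gamma>0 < \<infinity>" using r_fin \<gamma>0 by blast
  have k00: "k 0 = 0"
  proof (rule eq_0_if_square_bound_near_0)
    define B where "B = ennreal (exp \<gamma>0) * (ennreal 2 * ?r \<kappa> \<gamma>0 + ennreal (2 * \<gamma>0))"
    have B: "B < \<infinity>" unfolding B_def using fin0 by (auto simp: ennreal_mult_less_top)
    fix t assume t: "0 < t" "t \<le> \<gamma>0"
    have rB: "?r \<kappa> t \<le> B" unfolding B_def by (rule scalar_risk_bounded_near_0[where \<kappa>=\<kappa>, OF \<kappa>0 t])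
    then have "?r k t < B" using k[of t] t B by (auto intro: less_le_trans le_less_trans)
    have "exp (- \<gamma>0) * ((k 0 - t)\<^sup>2 / t) \<le> pmf (poisson_pmf t) 0 * scalar_loss t (k 0)"
      using t by (auto simp: scalar_loss_def intro!: divide_right_mono mult_right_mono)
    also have "ennreal \<dots> \<le> ?r k t"
      using point_loss_le_risk[of poisson_pmf t 0 scalar_loss k] by (simp add: ennreal_mult' del: pmf_poisson)
    then have "pmf (poisson_pmf t) 0 * scalar_loss t (k 0) \<le> enn2real B"
      using \<open>?r k t < B\<close> B
      by (subst ennreal_le_iff[symmetric]) (auto simp del: pmf_poisson)
    finally show "exp (- \<gamma>0) * ((k 0 - t)\<^sup>2 / t) \<le> enn2real B" .
  qed (use \<gamma>0 in auto)
  define \<kappa>' where "\<kappa>' z = \<kappa> z + w 1 * (k z - \<kappa> z) / w z" for z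
  have less: "G \<kappa>' \<gamma> < G \<kappa> \<gamma>" if \<gamma>: "0 < \<gamma>" and fin: "?r \<kappa> \<gamma> < \<infinity>" for \<gamma>
  proof -
    have g0: "0 \<le> g \<kappa> \<gamma> z" for \<kappa> z
      unfolding g_def using \<gamma> wz[of z] by (intro add_nonneg_nonneg mult_nonneg_nonneg) auto
    have l0: "0 \<le> w 1 * scalar_loss \<gamma> a" for a
      using scalar_loss_nonneg[OF \<gamma>] w1 by simp
    \<comment> \<open>At \<open>z = 0\<close> both estimators agree with \<open>\<kappa>\<close>; elsewhere \<open>w 1 \<le> w z\<close> absorbs the quadratic term.\<close>
    have pt: "g \<kappa>' \<gamma> z + w 1 * scalar_loss \<gamma> (\<kappa> z) \<le> g \<kappa> \<gamma> z + w 1 * scalar_loss \<gamma> (k z)" for z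
    proof (cases "z = 0")
      case True
      then show ?thesis by (simp add: \<kappa>'_def k00 \<kappa>0 g_def w_def)
    next
      case False
      have w: "0 < w z" using shrink_weight_pos[OF c p] False by (simp add: w_def)
      have w1z: "w 1 \<le> w z" using shrink_weight_1_le[OF c p] False by (simp add: w_def)
      define e where "e = k z - \<kappa> z"
      have ke: "k z = \<kappa> z + e" by (simp add: e_def)
      have "g \<kappa> \<gamma> z + w 1 * scalar_loss \<gamma> (k z) - (g \<kappa>' \<gamma> z + w 1 * scalar_loss \<gamma> (\<kappa> z))
          = w 1 * e\<^sup>2 * (w z - w 1) / (w z * \<gamma>)"
        using w \<gamma> unfolding scalar_loss_def \<kappa>'_def g_def e_def[symmetric] ke
        by (simp add: field_simps power2_eq_square)
      moreover have "0 \<le> w 1 * e\<^sup>2 * (w z - w 1) / (w z * \<gamma>)"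
        using w w1 w1z \<gamma> by simp
      ultimately show ?thesis by linarith
    qed
    have "G \<kappa>' \<gamma> + ennreal (w 1) * ?r \<kappa> \<gamma> = (\<integral>\<^sup>+z. ennreal (g \<kappa>' \<gamma> z + w 1 * scalar_loss \<gamma> (\<kappa> z)) \<partial>poisson_pmf \<gamma>)"
      using g0 l0 w1 by (simp add: G_def risk_def nn_integral_add nn_integral_cmult ennreal_mult' less_imp_le)
    also have "\<dots> \<le> (\<integral>\<^sup>+z. ennreal (g \<kappa> \<gamma> z + w 1 * scalar_loss \<gamma> (k z)) \<partial>poisson_pmf \<gamma>)"
      by (intro nn_integral_mono ennreal_leI pt)
    also have "\<dots> = G \<kappa> \<gamma> + ennreal (w 1) * ?r k \<gamma>"
      using g0 l0 w1 by (simp add: G_def risk_def nn_integral_add nn_integral_cmult ennreal_mult' less_imp_le)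
    finally show ?thesis
    proof (rule ennreal_less_of_add_le)
      have "?r k \<gamma> < ?r \<kappa> \<gamma>" using k \<gamma> fin by simp
      then show "ennreal (w 1) * ?r k \<gamma> < ennreal (w 1) * ?r \<kappa> \<gamma>"
        using w1 by (subst not_le[symmetric], subst ennreal_mult_le_mult_iff) auto
    qed (rule G_fin[OF \<gamma> fin])
  qed
  have vless: "?R (?\<delta> \<kappa>') \<theta> < ?R (?\<delta> \<kappa>) \<theta>" if \<theta>: "\<theta> \<in> ?V" and fin: "?R (?\<delta> \<kappa>) \<theta> < \<infinity>" for \<theta>
  proof -
    have "G \<kappa> (\<Sum>i\<in>UNIV. \<theta> i) < \<infinity>"
      using fin c \<theta> by (auto simp: risk_\<delta> ennreal_mult_less_top)
    then have "G \<kappa>' (\<Sum>i\<in>UNIV. \<theta> i) < G \<kappa> (\<Sum>i\<in>UNIV. \<theta> i)"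
      using sum_pos_vector[OF \<theta>] by (intro less r_fin)
    then show ?thesis unfolding risk_\<delta>[OF \<theta>]
      using c by (subst not_le[symmetric], subst ennreal_mult_le_mult_iff) auto
  qed
  then have "dominates ?V poisson_vector (vector_loss c) (?\<delta> \<kappa>') (?\<delta> \<kappa>)"
    unfolding dominates_def using \<theta>0
    by (metis infinity_ennreal_def less_imp_le less_top top_greatest)
  then show False using adm by (auto simp: admissible_def)
qed

theorem theorem3:
  fixes c :: real and \<kappa> :: "nat \<Rightarrow> real"
  assumes "0 \<le> c" and "2 \<le> CARD('n::finite)"
  shows "(admissible {0<..} poisson_pmf scalar_loss \<kappa> \<longrightarrow>
            admissible (positive_vectors :: ('n \<Rightarrow> real) set) poisson_vector (vector_loss c)
              (shrinkage_estimator c \<kappa>))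
         \<and> (\<kappa> 0 = 0 \<longrightarrow>
              (admissible (positive_vectors :: ('n \<Rightarrow> real) set) poisson_vector (vector_loss c)
                 (shrinkage_estimator c \<kappa>)
               \<longleftrightarrow> admissible {0<..} poisson_pmf scalar_loss \<kappa>))"
  using admissible_shrinkage_if_admissible_scalar[OF assms]
    admissible_scalar_if_admissible_shrinkage[OF assms] by blast

end
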